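(* Let $R$ be a commutative Noetherian ring with unity, $\lambda$ a length function on $R$-modules, $k\in\mathbb{N}$ and $S=R[x_1,\dots,x_k]$. Let $0\to A\xrightarrow{\iota} B\xrightarrow{\pi} C\to 0$ be an exact sequence of $S$-modules and assume that $B$ is locally $\lambda_R$-finite. Then $\mu(B)=\mu(A)\oplus\mu(C)$.
   Context: A length function on $R$-modules is a function $\lambda$ from $R$-modules to $\mathbb{R}_{\ge0}\cup\{\infty\}$ with $\lambda(0)=0$, invariant under isomorphism, additive on short exact sequences ($\lambda(B)=\lambda(A)+\lambda(C)$), and with $\lambda(M)=\sup\{\lambda(M'):M'\le M$ finitely generated $R$-submodule$\}$. An $R$-module (or $S$-module) $N$ is locally $\lambda_R$-finite if $\lambda(Rv)<\infty$ for every $v\in N$. An $S$-module $M$ is $\lambda_S$-small if it is finitely generated as an $S$-module and locally $\lambda_R$-finite. $S_n$ denotes the polynomials in $S$ of total degree $\le n$. If $M$ is $\lambda_S$-small (and $R$ Noetherian), choose a finitely generated $R$-submodule $V_0\le M$ with $\lambda(V_0)<\infty$ and $SV_0=M$; then $\lambda(S_nV_0)$ equals a polynomial $q(n)\in\mathbb{R}[n]$ of degree $\le k$ for all large $n$, and $\mu(M)$ is defined as the leading monomial $r t^d$ of $q$ (and $\mu(M)=0$ if $q=0$); it does not depend on $V_0$. Monomials $rt^d$ ($r\in\mathbb{R}_{\ge0}\cup\{\infty\}$, $d\in\{0,\dots,k\}$) are compared by: $rt^n\le st^m$ iff $n<m$, or $n=m$ and $r\le s$, with $0$ the minimum. For a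 family $I=\{r_it^{d_i}\}$, $\sup(I)=rt^d$ where $d=\max d_i$ and $r=\sup\{r_i: d_i=d\}$, and $\sup(\emptyset)=0$. For an arbitrary $S$-module $M$, $\mu(M)$ is the supremum of $\mu(M')$ over all $\lambda_S$-small $S$-submodules $M'\le M$. The operation $\oplus$ is: $rt^n\oplus st^m=rt^n$ if $n>m$, $=st^m$ if $n<m$, $=(r+s)t^n$ if $n=m$ (with $0$ as neutral element). *)

theory Defs
  imports "HOL-Algebra.Module" "HOL-Algebra.Ring_Divisibility"
    "HOL-Library.Extended_Nonnegative_Real" "HOL-Computational_Algebra.Polynomial"
begin

definition rhom :: "'r ring \<Rightarrow> ('r,'u) module \<Rightarrow> ('r,'v) module \<Rightarrow> ('u \<Rightarrow> 'v) set" where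
  "rhom R M N = {f. f \<in> carrier M \<rightarrow> carrier N
     \<and> (\<forall>x\<in>carrier M. \<forall>y\<in>carrier M. f (x \<oplus>\<^bsub>M\<^esub> y) = f x \<oplus>\<^bsub>N\<^esub> f y)
     \<and> (\<forall>a\<in>carrier R. \<forall>x\<in>carrier M. f (a \<odot>\<^bsub>M\<^esub> x) = a \<odot>\<^bsub>N\<^esub> f x)}"

definition riso :: "'r ring \<Rightarrow> ('r,'u) module \<Rightarrow> ('r,'v) module \<Rightarrow> bool" where
  "riso R M N \<longleftrightarrow> (\<exists>f \<in> rhom R M N. bij_betw f (carrier M) (carrier N))"

definition rsub :: "('r,'u) module \<Rightarrow> 'u set \<Rightarrow> ('r,'u) module" where
  "rsub M N = M\<lparr>carrier := N\<rparr>"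

definition rspan :: "'r ring \<Rightarrow> ('r,'u) module \<Rightarrow> 'u set \<Rightarrow> 'u set" where
  "rspan R M G = \<Inter>{N. submodule N R M \<and> G \<subseteq> N}"

definition fg_rsub :: "'r ring \<Rightarrow> ('r,'u) module \<Rightarrow> 'u set \<Rightarrow> bool" where
  "fg_rsub R M N \<longleftrightarrow> (\<exists>G. finite G \<and> G \<subseteq> carrier M \<and> N = rspan R M G)"

definition short_exact :: "'r ring \<Rightarrow> ('r,'a) module \<Rightarrow> ('r,'b) module \<Rightarrow> ('r,'c) module
    \<Rightarrow> ('a \<Rightarrow> 'b) \<Rightarrow> ('b \<Rightarrow> 'c) \<Rightarrow> bool" where
  "short_exact R A B C f g \<longleftrightarrow> f \<in> rhom R A B \<and> g \<in> rhom R B C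
     \<and> inj_on f (carrier A) \<and> g ` carrier B = carrier C
     \<and> f ` carrier A = {b \<in> carrier B. g b = \<zero>\<^bsub>C\<^esub>}"

definition length_function :: "'r ring \<Rightarrow> (('r,'u) module \<Rightarrow> ennreal) \<Rightarrow> bool" where
  "length_function R lam \<longleftrightarrow>
     (\<forall>M. module R M \<and> carrier M = {\<zero>\<^bsub>M\<^esub>} \<longrightarrow> lam M = 0)
   \<and> (\<forall>M N. module R M \<and> module R N \<and> riso R M N \<longrightarrow> lam M = lam N)
   \<and> (\<forall>A B C f g. module R A \<and> module R B \<and> module R C \<and> short_exact R A B C f g
        \<longrightarrow> lam B = lam A + lam C)
   \<and> (\<forall>M. module R M \<longrightarrow> lam M = (SUP N \<in> {N. fg_rsub R M N}. lam (rsub M N)))"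

definition loc_finite :: "'r ring \<Rightarrow> (('r,'u) module \<Rightarrow> ennreal) \<Rightarrow> ('r,'u) module \<Rightarrow> bool" where
  "loc_finite R lam M \<longleftrightarrow> (\<forall>v\<in>carrier M. lam (rsub M (rspan R M {v})) < \<infinity>)"

section \<open>S-modules, S = R[x_1,...,x_k]: an R-module with k commuting R-linear endomorphisms X 0, ..., X (k-1)\<close>

definition smodule :: "'r ring \<Rightarrow> nat \<Rightarrow> ('r,'u) module \<Rightarrow> (nat \<Rightarrow> 'u \<Rightarrow> 'u) \<Rightarrow> bool" where
  "smodule R k M X \<longleftrightarrow> module R M \<and> (\<forall>i<k. X i \<in> rhom R M M)
     \<and> (\<forall>i<k. \<forall>j<k. \<forall>v\<in>carrier M. X i (X j v) = X j (X i v))"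

definition shom :: "'r ring \<Rightarrow> nat \<Rightarrow> ('r,'u) module \<Rightarrow> (nat \<Rightarrow> 'u \<Rightarrow> 'u)
    \<Rightarrow> ('r,'v) module \<Rightarrow> (nat \<Rightarrow> 'v \<Rightarrow> 'v) \<Rightarrow> ('u \<Rightarrow> 'v) set" where
  "shom R k M X N Y = {f \<in> rhom R M N. \<forall>i<k. \<forall>v\<in>carrier M. f (X i v) = Y i (f v)}"

definition ssub :: "'r ring \<Rightarrow> nat \<Rightarrow> ('r,'u) module \<Rightarrow> (nat \<Rightarrow> 'u \<Rightarrow> 'u) \<Rightarrow> 'u set \<Rightarrow> bool" where
  "ssub R k M X N \<longleftrightarrow> submodule N R M \<and> (\<forall>i<k. \<forall>v\<in>N. X i v \<in> N)"

definition sspan :: "'r ring \<Rightarrow> nat \<Rightarrow> ('r,'u) module \<Rightarrow> (nat \<Rightarrow> 'u \<Rightarrow> 'u) \<Rightarrow> 'u set \<Rightarrow> 'u set" where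
  "sspan R k M X G = \<Inter>{N. ssub R k M X N \<and> G \<subseteq> N}"

definition fg_smod :: "'r ring \<Rightarrow> nat \<Rightarrow> ('r,'u) module \<Rightarrow> (nat \<Rightarrow> 'u \<Rightarrow> 'u) \<Rightarrow> bool" where
  "fg_smod R k M X \<longleftrightarrow> (\<exists>G. finite G \<and> G \<subseteq> carrier M \<and> sspan R k M X G = carrier M)"

definition lam_small :: "'r ring \<Rightarrow> (('r,'u) module \<Rightarrow> ennreal) \<Rightarrow> nat \<Rightarrow> ('r,'u) module
    \<Rightarrow> (nat \<Rightarrow> 'u \<Rightarrow> 'u) \<Rightarrow> bool" where
  "lam_small R lam k M X \<longleftrightarrow> fg_smod R k M X \<and> loc_finite R lam M"

text \<open>Action of the monomial x_{i1} ... x_{im} (list of variable indices) on v.\<close>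
definition monact :: "(nat \<Rightarrow> 'u \<Rightarrow> 'u) \<Rightarrow> nat list \<Rightarrow> 'u \<Rightarrow> 'u" where
  "monact X xs v = foldr X xs v"

definition Sn_span :: "'r ring \<Rightarrow> nat \<Rightarrow> ('r,'u) module \<Rightarrow> (nat \<Rightarrow> 'u \<Rightarrow> 'u) \<Rightarrow> nat \<Rightarrow> 'u set \<Rightarrow> 'u set" where
  "Sn_span R k M X n V = rspan R M {monact X xs v | xs v. set xs \<subseteq> {..<k} \<and> length xs \<le> n \<and> v \<in> V}"

section \<open>Monomials r t^d, with 0 as a separate least element\<close>

datatype lmono = MZero | Mon ennreal nat

fun mplus :: "lmono \<Rightarrow> lmono \<Rightarrow> lmono" where
  "mplus MZero m = m"
| "mplus m MZero = m"
| "mplus (Mon r n) (Mon s m) = (if n > m then Mon r n else if n < m then Mon s m else Mon (r + s) n)"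

definition msup :: "lmono set \<Rightarrow> lmono" where
  "msup I = (if I \<subseteq> {MZero} then MZero
     else (let d = Max {d. \<exists>r. Mon r d \<in> I} in Mon (SUP r \<in> {r. Mon r d \<in> I}. r) d))"

definition lead_mono :: "real poly \<Rightarrow> lmono" where
  "lead_mono q = (if q = 0 then MZero else Mon (ennreal (lead_coeff q)) (degree q))"

text \<open>mu for lambda_S-small modules (via any admissible V_0; the paper shows independence).\<close>
definition mu_small :: "'r ring \<Rightarrow> (('r,'u) module \<Rightarrow> ennreal) \<Rightarrow> nat \<Rightarrow> ('r,'u) module
    \<Rightarrow> (nat \<Rightarrow> 'u \<Rightarrow> 'u) \<Rightarrow> lmono" where
  "mu_small R lam k M X = (SOME m. \<exists>V0 q. fg_rsub R M V0 \<and> lam (rsub M V0) < \<infinity>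
       \<and> sspan R k M X V0 = carrier M \<and> degree q \<le> k
       \<and> (\<forall>\<^sub>F n in sequentially. 0 \<le> poly q (real n)
            \<and> lam (rsub M (Sn_span R k M X n V0)) = ennreal (poly q (real n)))
       \<and> m = lead_mono q)"

definition mu :: "'r ring \<Rightarrow> (('r,'u) module \<Rightarrow> ennreal) \<Rightarrow> nat \<Rightarrow> ('r,'u) module
    \<Rightarrow> (nat \<Rightarrow> 'u \<Rightarrow> 'u) \<Rightarrow> lmono" where
  "mu R lam k M X = msup {mu_small R lam k (rsub M N) X | N.
       ssub R k M X N \<and> lam_small R lam k (rsub M N) X}"

end

theory Submission
  imports Defs
begin

text \<open>
  For a finitely generated \<open>R\<close>-submodule \<open>V\<close> that generates \<open>B\<close> over \<open>S\<close>, the filtration \<open>S_n V\<close> is a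
  graded module over \<open>R[x_1, ..., x_k, t]\<close>, with \<open>t\<close> acting by inclusion. A graded form of Hilbert's
  basis theorem, applied to \<open>A \<inter> S_n V\<close>, yields \<open>A \<inter> S_(n+c) V = S_n W\<close> for some finitely generated
  \<open>W\<close> and some \<open>c\<close>, so that the growth functions satisfy
  \<open>\<lambda>(S_(n+c) V) = \<lambda>(S_n W) + \<lambda>(S_(n+c) \<pi>(V))\<close>. All three are eventually polynomial, by induction on
  the number of variables through kernel and cokernel of the last one, and comparing leading terms
  gives the theorem for small \<open>B\<close>. In general, every pair of small submodules of \<open>A\<close> and \<open>C\<close> is
  dominated by a small submodule of \<open>B\<close>, and \<open>\<oplus>\<close> commutes with suprema.

  Since \<open>\<lambda>\<close> is only given on modules with carrier in one fixed type, neither direct sums nor quotients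
  by cosets are available: graded modules are encoded as sequences of pairs \<open>Q n \<subseteq> P n\<close> of
  submodules of one ambient module, standing for \<open>P n / Q n\<close>.
\<close>

section \<open>Leading monomials\<close>

text \<open>The obstacle is that \<open>A \<inter> S_n V\<close> is in general not
  \<open>S_n W\<close> for any \<open>W\<close>: elements of \<open>A\<close> can arise in
  \<open>S_n V\<close> by cancellation among multiples of generators that lie outside
  \<open>A\<close>. Inclusion as an extra variable records in which degree an element appears, so
  finite generation of the graded kernel supplies a degree c past which the intersection grows only
  by applying variables. This is the pattern of the Artin-Rees lemma. The offset c is harmless,
  because passing from n to n + c changes neither the degree nor the leading coefficient of a
  polynomial. The same fact makes the leading monomial independent of the generating submodule,
  which is what allows the choice operator in \<open>mu_small\<close> to be evaluated. Local
  finiteness enters where lengths have to be subtracted: it makes them real numbers.\<close>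

fun mono_le :: "lmono \<Rightarrow> lmono \<Rightarrow> bool" where
  "mono_le MZero m = True"
| "mono_le (Mon r n) MZero = False"
| "mono_le (Mon r n) (Mon s m) = (n < m \<or> n = m \<and> r \<le> s)"

lemma mono_le_refl [simp]: "mono_le a a"
  by (cases a) auto

lemma mono_le_trans: "mono_le a b \<Longrightarrow> mono_le b c \<Longrightarrow> mono_le a c"
  by (cases a; cases b; cases c) auto

lemma mono_le_antisym: "mono_le a b \<Longrightarrow> mono_le b a \<Longrightarrow> a = b"
  by (cases a; cases b) auto

lemma mplus_MZero_right [simp]: "mplus a MZero = a"
  by (cases a) auto

lemma mplus_commute: "mplus a b = mplus b a"
  by (cases a; cases b) (auto simp: add.commute)

lemma mplus_mono: "mono_le a a' \<Longrightarrow> mono_le b b' \<Longrightarrow> mono_le (mplus a b) (mplus a' b')"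
  by (cases a; cases b; cases a'; cases b') (auto intro: add_mono add_increasing add_increasing2)

text \<open>The degree bound makes the set of occurring degrees finite, so the \<open>Max\<close> in
  \<open>msup\<close> is attained. The witness \<open>r0\<close> records this; the supremum of the
  coefficients in that degree need not be attained.\<close>

lemma msup_cases:
  assumes "\<And>r d. Mon r d \<in> I \<Longrightarrow> d \<le> k"
  obtains "I \<subseteq> {MZero}" "msup I = MZero"
  | r0 d where "Mon r0 d \<in> I" "\<And>r e. Mon r e \<in> I \<Longrightarrow> e \<le> d" "msup I = Mon (SUP r \<in> {r. Mon r d \<in> I}. r) d"
proof (cases "I \<subseteq> {MZero}")
  case True
  then show ?thesis using that(1) by (simp add: msup_def)
next
  case False
  define D where "D = {d. \<exists>r. Mon r d \<in> I}"
  have fin: "finite D"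
    by (rule finite_subset[of _ "{..k}"]) (use assms in \<open>auto simp: D_def\<close>)
  from False obtain m where "m \<in> I" "m \<noteq> MZero" by auto
  then have "D \<noteq> {}" unfolding D_def by (cases m) auto
  then have "Max D \<in> D" using fin by (rule Max_in[rotated])
  then obtain r0 where "Mon r0 (Max D) \<in> I" unfolding D_def by auto
  moreover have "e \<le> Max D" if "Mon r e \<in> I" for r e
    by (rule Max_ge[OF fin]) (use that in \<open>auto simp: D_def\<close>)
  moreover have "msup I = Mon (SUP r \<in> {r. Mon r (Max D) \<in> I}. r) (Max D)"
    using False by (simp add: msup_def D_def Let_def)
  ultimately show ?thesis by (rule that(2))
qed

lemma msup_upper:
  assumes bd: "\<And>r d. Mon r d \<in> I \<Longrightarrow> d \<le> k" and a: "a \<in> I"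
  shows "mono_le a (msup I)"
proof -
  consider (zero) "I \<subseteq> {MZero}" "msup I = MZero"
    | (mon) r0 d where "Mon r0 d \<in> I" "\<And>r e. Mon r e \<in> I \<Longrightarrow> e \<le> d"
        "msup I = Mon (SUP r \<in> {r. Mon r d \<in> I}. r) d"
    using bd by (rule msup_cases) blast+
  then show ?thesis
  proof cases
    case zero
    then show ?thesis using a by auto
  next
    case (mon r0 d)
    show ?thesis
    proof (cases a)
      case (Mon r e)
      with a mon(2) have "e \<le> d" by auto
      moreover have "r \<le> (SUP r \<in> {r. Mon r d \<in> I}. r)" if "e = d"
        using a Mon that by (intro SUP_upper) auto
      ultimately show ?thesis using Mon mon(3) by (cases "e = d") auto
    qed auto
  qed
qed

text \<open>This is continuity of \<open>mplus\<close> in one argument. The top degree of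
  \<open>I\<close> is attained, so comparing it with the degree of \<open>c\<close> decides which
  branch of \<open>mplus\<close> applies. Coefficients interact only for equal degrees, and there
  addition commutes with a supremum over a nonempty set. For empty \<open>I\<close> nothing would
  bound \<open>c\<close> by \<open>u\<close>.\<close>

lemma mplus_msup_least:
  assumes bd: "\<And>r d. Mon r d \<in> I \<Longrightarrow> d \<le> k" and ne: "I \<noteq> {}"
    and ub: "\<And>a. a \<in> I \<Longrightarrow> mono_le (mplus a c) u"
  shows "mono_le (mplus (msup I) c) u"
proof -
  consider (zero) "I \<subseteq> {MZero}" "msup I = MZero"
    | (mon) r0 d where "Mon r0 d \<in> I" "\<And>r e. Mon r e \<in> I \<Longrightarrow> e \<le> d"
        "msup I = Mon (SUP r \<in> {r. Mon r d \<in> I}. r) d"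
    using bd by (rule msup_cases) blast+
  then show ?thesis
  proof cases
    case zero
    with ne have "MZero \<in> I" by auto
    from ub[OF this] show ?thesis using zero by simp
  next
    case (mon r0 d)
    let ?S = "{r. Mon r d \<in> I}"
    have ne': "?S \<noteq> {}" using mon(1) by auto
    show ?thesis
    proof (cases c)
      case MZero
      show ?thesis
      proof (cases u)
        case MZero
        then show ?thesis using ub[OF mon(1)] \<open>c = MZero\<close> by simp
      next
        case (Mon s e)
        have *: "d < e \<or> d = e \<and> r \<le> s" if "r \<in> ?S" for r
          using ub[of "Mon r d"] that Mon \<open>c = MZero\<close> by auto
        have "(SUP r \<in> ?S. r) \<le> s" if "\<not> d < e" using * that by (intro SUP_least) auto
        then show ?thesis using *[of r0] mon Mon \<open>c = MZero\<close> by auto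
      qed
    next
      case (Mon t f)
      show ?thesis
      proof (cases u)
        case MZero
        then show ?thesis using ub[OF mon(1)] Mon by (auto split: if_splits)
      next
        case (Mon s e)
        have *: "mono_le (mplus (Mon r d) (Mon t f)) (Mon s e)" if "r \<in> ?S" for r
          using ub[of "Mon r d"] that Mon \<open>c = Mon t f\<close> by auto
        consider "d < f" | "d > f" | "d = f" by linarith
        then show ?thesis
        proof cases
          case 1
          then show ?thesis using *[of r0] mon Mon \<open>c = Mon t f\<close> by auto
        next
          case 2
          then have "(SUP r \<in> ?S. r) \<le> s" if "\<not> d < e" using * that by (intro SUP_least) auto
          then show ?thesis using *[of r0] 2 mon Mon \<open>c = Mon t f\<close> by auto
        next
          case eq: 3
          have "(SUP r \<in> ?S. r) + t = (SUP r \<in> ?S. r + t)"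
            using ne' by (subst ennreal_SUP_add_left) auto
          moreover have "(SUP r \<in> ?S. r + t) \<le> s" if "\<not> d < e" using * that eq by (intro SUP_least) auto
          ultimately show ?thesis using *[of r0] eq mon Mon \<open>c = Mon t f\<close> by auto
        qed
      qed
    qed
  qed
qed

lemma msup_least:
  assumes "\<And>r d. Mon r d \<in> I \<Longrightarrow> d \<le> k" and "\<And>a. a \<in> I \<Longrightarrow> mono_le a u"
  shows "mono_le (msup I) u"
proof (cases "I = {}")
  case True
  then show ?thesis by (simp add: msup_def)
next
  case False
  then show ?thesis using mplus_msup_least[of I k MZero u] assms by simp
qed

section \<open>Real polynomials and their values at large integers\<close>

lemma poly_antidifference:
  fixes q :: "real poly"
  assumes "\<And>i. i \<ge> m \<Longrightarrow> coeff q i = 0"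
  obtains p where "\<And>i. i \<ge> Suc m \<Longrightarrow> coeff p i = 0" "\<And>x. poly p (x + 1) - poly p x = poly q x"
proof -
  have "\<exists>p. (\<forall>i\<ge>Suc m. coeff p i = 0) \<and> (\<forall>x. poly p (x + 1) - poly p x = poly q x)"
    using assms
  proof (induction m arbitrary: q)
    case 0
    then have "q = 0" by (intro poly_eqI) auto
    then show ?case by (intro exI[of _ 0]) auto
  next
    case (Suc m)
    \<comment> \<open>The difference of x^(m+1) has leading term (m+1) x^m, so this multiple cancels
      the top coefficient of \<open>q\<close> and leaves a polynomial covered by the induction
      hypothesis.\<close>
    define c where "c = coeff q m / real (Suc m)"
    define d where "d = smult c ([:1, 1:] ^ Suc m - monom 1 (Suc m))"
    have cd: "coeff d i = c * (real (Suc m choose i) - (if i = Suc m then 1 else 0))" for i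
    proof -
      have "coeff ([:1, 1:] ^ Suc m) i = real (Suc m choose i)"
      proof (cases "i \<le> Suc m")
        case True
        then show ?thesis by (subst coeff_linear_poly_power) auto
      next
        case False
        then show ?thesis
          by (subst coeff_eq_0) (auto simp: degree_linear_power simp del: power_Suc)
      qed
      then show ?thesis unfolding d_def by (simp del: power_Suc binomial_Suc_Suc)
    qed
    have "coeff (q - d) i = 0" if "i \<ge> m" for i
    proof (cases "i = m")
      case True
      then show ?thesis unfolding coeff_diff cd by (simp add: c_def)
    next
      case False
      then have "i \<ge> Suc m" using that by simp
      then show ?thesis unfolding coeff_diff cd using Suc.prems[of i] by (cases "i = Suc m") auto
    qed
    from Suc.IH[OF this] obtain p where p: "\<forall>i\<ge>Suc m. coeff p i = 0"
      "\<forall>x. poly p (x + 1) - poly p x = poly (q - d) x" by blast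
    show ?case
    proof (intro exI[of _ "p + monom c (Suc m)"] conjI allI impI)
      fix i assume "i \<ge> Suc (Suc m)"
      then show "coeff (p + monom c (Suc m)) i = 0" using p(1) by auto
    next
      fix x :: real
      have "poly d x = c * (x + 1) ^ Suc m - c * x ^ Suc m"
        unfolding d_def by (simp add: poly_monom algebra_simps del: power_Suc)
      then show "poly (p + monom c (Suc m)) (x + 1) - poly (p + monom c (Suc m)) x = poly q x"
        using p(2)[rule_format, of x] by (simp add: poly_monom del: power_Suc)
    qed
  qed
  then show ?thesis using that by blast
qed

text \<open>Summation raises the degree by one, so \<open>m\<close> possible coefficients become
  \<open>Suc m\<close>. Bounding coefficients instead of the degree lets \<open>m = 0\<close> mean
  the zero polynomial.\<close>

lemma eventually_poly_of_difference:
  fixes f :: "nat \<Rightarrow> real"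
  assumes "\<And>i. i \<ge> m \<Longrightarrow> coeff q i = 0"
    and "\<forall>\<^sub>F n in sequentially. f (Suc n) - f n = poly q (real n)"
  shows "\<exists>p. (\<forall>i\<ge>Suc m. coeff p i = 0) \<and> (\<forall>\<^sub>F n in sequentially. f n = poly p (real n))"
proof -
  obtain p where p: "\<And>i. i \<ge> Suc m \<Longrightarrow> coeff p i = 0" "\<And>x. poly p (x + 1) - poly p x = poly q x"
    using poly_antidifference assms(1) by blast
  from assms(2) obtain n0 where n0: "\<And>n. n \<ge> n0 \<Longrightarrow> f (Suc n) - f n = poly q (real n)"
    unfolding eventually_sequentially by blast
  \<comment> \<open>From \<open>n0\<close> on both sequences have the same differences, hence they
    differ by their gap at \<open>n0\<close>.\<close>
  define c where "c = f n0 - poly p (real n0)"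
  have "f n = poly p (real n) + c" if "n \<ge> n0" for n
    using that
  proof (induction n rule: dec_induct)
    case base
    then show ?case by (simp add: c_def)
  next
    case (step n)
    have "f (Suc n) = f n + poly q (real n)" using n0[OF step.hyps(1)] by simp
    also have "\<dots> = poly p (real n + 1) + c" using step.IH p(2)[of "real n"] by simp
    finally show ?case by (simp add: add.commute)
  qed
  then have "\<forall>\<^sub>F n in sequentially. f n = poly (p + [:c:]) (real n)"
    unfolding eventually_sequentially by auto
  moreover have "coeff (p + [:c:]) i = 0" if "i \<ge> Suc m" for i
    using that p(1)[of i] by (cases i) auto
  ultimately show ?thesis by blast
qed

lemma lead_coeff_pos_of_eventually_nonneg:
  fixes q :: "real poly"
  assumes "q \<noteq> 0" "\<forall>\<^sub>F n in sequentially. 0 \<le> poly q (real n)"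
  shows "lead_coeff q > 0"
proof (rule ccontr)
  assume "\<not> lead_coeff q > 0"
  with assms(1) have neg: "lead_coeff q < 0"
    by (metis leading_coeff_0_iff linorder_neqE_linordered_idom)
  then obtain x0 where x0: "\<And>x. x \<ge> x0 \<Longrightarrow> poly (- q) x \<ge> lead_coeff (- q)"
    using poly_pinfty_gt_lc[of "- q"] by auto
  have "\<forall>\<^sub>F n in sequentially. x0 \<le> real n"
    using filterlim_real_sequentially by (auto simp: filterlim_at_top)
  with assms(2) have "\<forall>\<^sub>F n in sequentially. False"
    by eventually_elim (use x0 neg in force)
  then show False by simp
qed

text \<open>The sign of the leading coefficient of \<open>q - p\<close> decides the comparison.
  Eventual nonnegativity of \<open>p\<close> matters because \<open>ennreal\<close> truncates
  negative numbers to 0 while \<open>lead_mono\<close> keeps the degree.\<close>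

lemma lead_mono_mono:
  assumes p: "\<forall>\<^sub>F n in sequentially. 0 \<le> poly p (real n)"
    and pq: "\<forall>\<^sub>F n in sequentially. poly p (real n) \<le> poly q (real n)"
  shows "mono_le (lead_mono p) (lead_mono q)"
proof (cases "p = 0 \<or> p = q")
  case True
  then show ?thesis by (auto simp: lead_mono_def)
next
  case False
  have pp: "lead_coeff p > 0" using lead_coeff_pos_of_eventually_nonneg[OF _ p] False by auto
  have d: "lead_coeff (q - p) > 0"
    by (rule lead_coeff_pos_of_eventually_nonneg) (use False pq in auto)
  have deg: "degree p \<le> degree q"
  proof (rule ccontr)
    assume neg: "\<not> ?thesis"
    then have "degree (- p + q) = degree p" using degree_add_eq_left[of q "- p"] by simp
    moreover have "coeff q (degree p) = 0" using neg by (intro coeff_eq_0) auto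
    ultimately show False using d pp by simp
  qed
  have q0: "q \<noteq> 0" using d pp by auto
  have "lead_coeff p \<le> lead_coeff q" if e: "degree p = degree q"
  proof (cases "degree (q - p) = degree q")
    case True
    then show ?thesis using d e by simp
  next
    case False
    moreover have "degree (q - p) \<le> degree q" using degree_diff_le[of q "degree q" p] e by simp
    ultimately have "coeff (q - p) (degree q) = 0" by (intro coeff_eq_0) auto
    then show ?thesis using e by simp
  qed
  then show ?thesis using False q0 deg by (auto simp: lead_mono_def ennreal_leI)
qed

text \<open>This is what lets an offset between two filtrations disappear in the leading
  monomial.\<close>

lemma lead_mono_shift: "lead_mono (q \<circ>\<^sub>p [:c, 1:]) = lead_mono q"
  using lead_coeff_comp[of "[:c, 1:]" q] degree_pcompose[of q "[:c, 1:]"] pcompose_eq_0[of q "[:c, 1:]"]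
  by (cases "q = 0") (auto simp: lead_mono_def)

text \<open>Both leading coefficients are positive and cannot cancel, so equal degrees behave as
  \<open>mplus\<close> prescribes.\<close>

lemma lead_mono_add:
  assumes p: "\<forall>\<^sub>F n in sequentially. 0 \<le> poly p (real n)"
    and q: "\<forall>\<^sub>F n in sequentially. 0 \<le> poly q (real n)"
  shows "lead_mono (p + q) = mplus (lead_mono p) (lead_mono q)"
proof (cases "p = 0 \<or> q = 0")
  case True
  then show ?thesis by (auto simp: lead_mono_def)
next
  case False
  then have pp: "lead_coeff p > 0" and qq: "lead_coeff q > 0"
    using lead_coeff_pos_of_eventually_nonneg p q by auto
  consider "degree p < degree q" | "degree p > degree q" | "degree p = degree q" by linarith
  then show ?thesis
  proof cases
    case 1
    then have "p + q \<noteq> 0" "degree (p + q) = degree q" "lead_coeff (p + q) = lead_coeff q"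
      using degree_add_eq_right[of p q] lead_coeff_add_le[of p q] by auto
    then show ?thesis using 1 False by (simp add: lead_mono_def)
  next
    case 2
    then have "p + q \<noteq> 0" "degree (p + q) = degree p" "lead_coeff (p + q) = lead_coeff p"
      using degree_add_eq_right[of q p] lead_coeff_add_le[of q p] by (auto simp: add.commute)
    then show ?thesis using 2 False by (simp add: lead_mono_def)
  next
    case 3
    have c: "coeff (p + q) (degree p) = lead_coeff p + lead_coeff q" using 3 by simp
    then have "coeff (p + q) (degree p) \<noteq> 0" using pp qq by simp
    then have "degree (p + q) = degree p"
      using le_degree[of "p + q" "degree p"] degree_add_le[of p "degree p" q] 3 by simp
    moreover have "p + q \<noteq> 0" using \<open>coeff (p + q) (degree p) \<noteq> 0\<close> by (metis coeff_0)
    ultimately show ?thesis using 3 False c pp qq by (simp add: lead_mono_def ennreal_plus)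
  qed
qed

section \<open>Submodules and finite generation\<close>

text \<open>Closure under negation comes from multiplication by -1, which leaves fewer conditions to
  check for each new submodule.\<close>

lemma submodule_iff:
  fixes R :: "'r ring" and M :: "('r,'u) module"
  assumes "module R M"
  shows "submodule N R M \<longleftrightarrow> N \<subseteq> carrier M \<and> \<zero>\<^bsub>M\<^esub> \<in> N
    \<and> (\<forall>x\<in>N. \<forall>y\<in>N. x \<oplus>\<^bsub>M\<^esub> y \<in> N) \<and> (\<forall>a\<in>carrier R. \<forall>x\<in>N. a \<odot>\<^bsub>M\<^esub> x \<in> N)" (is "?L \<longleftrightarrow> ?R")
proof
  interpret module R M by fact
  {
    assume L: ?L
    then interpret submodule N R M .
    show ?R using one_closed m_closed smult_closed subset by auto
  }
  assume r: ?R
  show ?L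
  proof (rule submoduleI)
    fix x assume x: "x \<in> N"
    then have "(\<ominus>\<^bsub>R\<^esub> \<one>\<^bsub>R\<^esub>) \<odot>\<^bsub>M\<^esub> x \<in> N" using r by simp
    moreover have "x \<in> carrier M" using x r by blast
    ultimately show "\<ominus>\<^bsub>M\<^esub> x \<in> N" using smult_l_minus[of "\<one>\<^bsub>R\<^esub>" x] by simp
  qed (use r in auto)
qed

lemma submoduleD:
  fixes R :: "'r ring" and M :: "('r,'u) module"
  assumes "module R M" "submodule N R M"
  shows "N \<subseteq> carrier M" "\<zero>\<^bsub>M\<^esub> \<in> N" "\<And>x. x \<in> N \<Longrightarrow> x \<in> carrier M"
    "\<And>x y. x \<in> N \<Longrightarrow> y \<in> N \<Longrightarrow> x \<oplus>\<^bsub>M\<^esub> y \<in> N"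
    "\<And>a x. a \<in> carrier R \<Longrightarrow> x \<in> N \<Longrightarrow> a \<odot>\<^bsub>M\<^esub> x \<in> N"
    "\<And>x. x \<in> N \<Longrightarrow> \<ominus>\<^bsub>M\<^esub> x \<in> N"
    "\<And>x y. x \<in> N \<Longrightarrow> y \<in> N \<Longrightarrow> x \<ominus>\<^bsub>M\<^esub> y \<in> N"
proof -
  interpret module R M by fact
  show s: "N \<subseteq> carrier M" "\<zero>\<^bsub>M\<^esub> \<in> N" "\<And>x. x \<in> N \<Longrightarrow> x \<in> carrier M"
    "\<And>x y. x \<in> N \<Longrightarrow> y \<in> N \<Longrightarrow> x \<oplus>\<^bsub>M\<^esub> y \<in> N"
    "\<And>a x. a \<in> carrier R \<Longrightarrow> x \<in> N \<Longrightarrow> a \<odot>\<^bsub>M\<^esub> x \<in> N"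
    using assms(2) unfolding submodule_iff[OF assms(1)] by auto
  show n: "\<And>x. x \<in> N \<Longrightarrow> \<ominus>\<^bsub>M\<^esub> x \<in> N" using submoduleE(3)[OF assms(2)] .
  show "\<And>x y. x \<in> N \<Longrightarrow> y \<in> N \<Longrightarrow> x \<ominus>\<^bsub>M\<^esub> y \<in> N" unfolding a_minus_def using s n by auto
qed

lemma rhomD:
  assumes "f \<in> rhom R M N"
  shows "\<And>x. x \<in> carrier M \<Longrightarrow> f x \<in> carrier N"
    "\<And>x y. x \<in> carrier M \<Longrightarrow> y \<in> carrier M \<Longrightarrow> f (x \<oplus>\<^bsub>M\<^esub> y) = f x \<oplus>\<^bsub>N\<^esub> f y"
    "\<And>a x. a \<in> carrier R \<Longrightarrow> x \<in> carrier M \<Longrightarrow> f (a \<odot>\<^bsub>M\<^esub> x) = a \<odot>\<^bsub>N\<^esub> f x"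
  using assms unfolding rhom_def by auto

lemma rhom_zero:
  assumes "module R M" "module R N" "f \<in> rhom R M N"
  shows "f \<zero>\<^bsub>M\<^esub> = \<zero>\<^bsub>N\<^esub>"
proof -
  interpret M: module R M by fact
  interpret N: module R N by fact
  have "f (\<zero>\<^bsub>R\<^esub> \<odot>\<^bsub>M\<^esub> \<zero>\<^bsub>M\<^esub>) = \<zero>\<^bsub>R\<^esub> \<odot>\<^bsub>N\<^esub> f \<zero>\<^bsub>M\<^esub>" by (rule rhomD(3)[OF assms(3)]) auto
  then show ?thesis using rhomD(1)[OF assms(3)] by simp
qed

lemma rsub_simps [simp]:
  "carrier (rsub M N) = N" "(\<oplus>\<^bsub>rsub M N\<^esub>) = (\<oplus>\<^bsub>M\<^esub>)" "(\<odot>\<^bsub>rsub M N\<^esub>) = (\<odot>\<^bsub>M\<^esub>)"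
  "\<zero>\<^bsub>rsub M N\<^esub> = \<zero>\<^bsub>M\<^esub>" "rsub (rsub M N) N' = rsub M N'"
  by (auto simp: rsub_def)

lemma module_rsub: "module R M \<Longrightarrow> submodule N R M \<Longrightarrow> module R (rsub M N)"
  unfolding rsub_def by (rule submodule.submodule_is_module)

lemma submodule_rsub_iff:
  fixes R :: "'r ring" and M :: "('r,'u) module"
  assumes "module R M" "submodule N R M"
  shows "submodule V R (rsub M N) \<longleftrightarrow> submodule V R M \<and> V \<subseteq> N"
  using submodule_iff[OF module_rsub[OF assms]] submodule_iff[OF assms(1)] submoduleD(1)[OF assms] by auto

lemma rspan_superset: "G \<subseteq> rspan R M G"
  unfolding rspan_def by auto

lemma rspan_least: "submodule N R M \<Longrightarrow> G \<subseteq> N \<Longrightarrow> rspan R M G \<subseteq> N"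
  unfolding rspan_def by auto

lemma rspan_of_submodule: "submodule N R M \<Longrightarrow> rspan R M N = N"
  by (intro equalityI rspan_superset rspan_least order_refl)

lemma rspan_mono: "G \<subseteq> G' \<Longrightarrow> rspan R M G \<subseteq> rspan R M G'"
  unfolding rspan_def by auto

lemma submodule_carrier: "module R M \<Longrightarrow> submodule (carrier M) R M"
  by (rule module.carrier_is_submodule)

lemma submodule_rspan:
  fixes R :: "'r ring" and M :: "('r,'u) module"
  assumes "module R M" "G \<subseteq> carrier M"
  shows "submodule (rspan R M G) R M"
proof -
  let ?S = "{N. submodule N R M \<and> G \<subseteq> N}"
  have c: "carrier M \<in> ?S" using assms submodule_carrier by auto
  have s: "\<And>N. N \<in> ?S \<Longrightarrow> submodule N R M" by simp
  note D = submoduleD[OF assms(1) s]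
  show ?thesis unfolding rspan_def
  proof (subst submodule_iff[OF assms(1)], intro conjI ballI)
    show "\<Inter>?S \<subseteq> carrier M" using c by (rule Inter_lower)
    show "\<zero>\<^bsub>M\<^esub> \<in> \<Inter>?S" by (rule InterI) (rule D(2))
    fix x y assume "x \<in> \<Inter>?S" "y \<in> \<Inter>?S"
    then show "x \<oplus>\<^bsub>M\<^esub> y \<in> \<Inter>?S" by (intro InterI D(4)) auto
  next
    fix a x assume "a \<in> carrier R" "x \<in> \<Inter>?S"
    then show "a \<odot>\<^bsub>M\<^esub> x \<in> \<Inter>?S" by (intro InterI D(5)) auto
  qed
qed

lemma rspan_subset_carrier: "module R M \<Longrightarrow> G \<subseteq> carrier M \<Longrightarrow> rspan R M G \<subseteq> carrier M"
  by (rule rspan_least[OF submodule_carrier])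

text \<open>Submodules of \<open>N\<close> are submodules of \<open>M\<close> inside
  \<open>N\<close>, so spans can be computed in one ambient module throughout.\<close>

lemma rspan_rsub:
  fixes R :: "'r ring" and M :: "('r,'u) module"
  assumes "module R M" "submodule N R M" "G \<subseteq> N"
  shows "rspan R (rsub M N) G = rspan R M G"
proof
  note N = submodule_rsub_iff[OF assms(1,2)]
  have s: "submodule (rspan R M G) R M" using submodule_rspan assms submoduleD(1)[OF assms(1,2)] by blast
  moreover have "rspan R M G \<subseteq> N" by (rule rspan_least) fact+
  ultimately show "rspan R (rsub M N) G \<subseteq> rspan R M G"
    by (intro rspan_least) (auto simp: N rspan_superset)
  have "submodule (rspan R (rsub M N) G) R (rsub M N)"
    by (rule submodule_rspan[OF module_rsub]) (use assms in auto)
  then show "rspan R M G \<subseteq> rspan R (rsub M N) G"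
    by (intro rspan_least rspan_superset) (auto simp: N)
qed

lemma submodule_Int:
  fixes R :: "'r ring" and M :: "('r,'u) module"
  assumes "module R M" "submodule U R M" "submodule V R M"
  shows "submodule (U \<inter> V) R M"
  using assms unfolding submodule_iff[OF assms(1)] by auto

lemma submodule_zero:
  fixes R :: "'r ring" and M :: "('r,'u) module"
  assumes "module R M"
  shows "submodule {\<zero>\<^bsub>M\<^esub>} R M"
proof -
  interpret module R M by fact
  show ?thesis unfolding submodule_iff[OF assms] by auto
qed

lemma submodule_UN_chain:
  fixes R :: "'r ring" and M :: "('r,'u) module" and C :: "nat \<Rightarrow> 'u set"
  assumes "module R M" "\<And>j. submodule (C j) R M" "mono C"
  shows "submodule (\<Union>j. C j) R M"
proof -
  have add: "x \<oplus>\<^bsub>M\<^esub> y \<in> (\<Union>j. C j)" if "x \<in> C i" "y \<in> C j" for x y i j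
  proof -
    have "x \<in> C (max i j)" "y \<in> C (max i j)"
      using that monoD[OF assms(3), of i "max i j"] monoD[OF assms(3), of j "max i j"] by auto
    then show ?thesis using submoduleD(4)[OF assms(1,2)] by blast
  qed
  note C = submoduleD[OF assms(1,2)]
  show ?thesis unfolding submodule_iff[OF assms(1)]
  proof (intro conjI ballI)
    fix x y assume "x \<in> (\<Union>j. C j)" "y \<in> (\<Union>j. C j)"
    then show "x \<oplus>\<^bsub>M\<^esub> y \<in> (\<Union>j. C j)" using add by blast
  next
    fix a x assume "a \<in> carrier R" "x \<in> (\<Union>j. C j)"
    then show "a \<odot>\<^bsub>M\<^esub> x \<in> (\<Union>j. C j)" using C(5) by blast
  qed (use C(2,3) in blast)+
qed

section \<open>Sums, images and preimages of submodules\<close>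

lemma set_add_mem: "x \<in> U <+>\<^bsub>M\<^esub> V \<longleftrightarrow> (\<exists>u\<in>U. \<exists>v\<in>V. x = u \<oplus>\<^bsub>M\<^esub> v)"
  unfolding set_add_def' by auto

lemma submodule_set_add:
  fixes R :: "'r ring" and M :: "('r,'u) module"
  assumes "module R M" "submodule U R M" "submodule V R M"
  shows "submodule (U <+>\<^bsub>M\<^esub> V) R M"
proof -
  interpret module R M by fact
  note U = submoduleD[OF assms(1,2)] and V = submoduleD[OF assms(1,3)]
  show ?thesis unfolding submodule_iff[OF assms(1)]
  proof (intro conjI ballI subsetI)
    show "\<zero>\<^bsub>M\<^esub> \<in> U <+>\<^bsub>M\<^esub> V" unfolding set_add_mem using U(2) V(2)
      by (intro bexI[of _ "\<zero>\<^bsub>M\<^esub>"]) auto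
  next
    fix x y assume "x \<in> U <+>\<^bsub>M\<^esub> V" "y \<in> U <+>\<^bsub>M\<^esub> V"
    then obtain u v u' v' where *: "u \<in> U" "v \<in> V" "u' \<in> U" "v' \<in> V" "x = u \<oplus>\<^bsub>M\<^esub> v" "y = u' \<oplus>\<^bsub>M\<^esub> v'"
      unfolding set_add_mem by blast
    then have "x \<oplus>\<^bsub>M\<^esub> y = (u \<oplus>\<^bsub>M\<^esub> u') \<oplus>\<^bsub>M\<^esub> (v \<oplus>\<^bsub>M\<^esub> v')"
      using U(3) V(3) by (simp add: M.a_ac)
    then show "x \<oplus>\<^bsub>M\<^esub> y \<in> U <+>\<^bsub>M\<^esub> V" unfolding set_add_mem using * U(4) V(4) by blast
  next
    fix a x assume "a \<in> carrier R" "x \<in> U <+>\<^bsub>M\<^esub> V"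
    then obtain u v where *: "u \<in> U" "v \<in> V" "x = u \<oplus>\<^bsub>M\<^esub> v" unfolding set_add_mem by blast
    then have "a \<odot>\<^bsub>M\<^esub> x = a \<odot>\<^bsub>M\<^esub> u \<oplus>\<^bsub>M\<^esub> a \<odot>\<^bsub>M\<^esub> v"
      using \<open>a \<in> carrier R\<close> U(3) V(3) by (simp add: smult_r_distr)
    then show "a \<odot>\<^bsub>M\<^esub> x \<in> U <+>\<^bsub>M\<^esub> V" unfolding set_add_mem
      using U(5) V(5) \<open>a \<in> carrier R\<close> * by blast
  qed (use U(3) V(3) in \<open>auto simp: set_add_mem\<close>)
qed

lemma subset_set_add1:
  fixes R :: "'r ring" and M :: "('r,'u) module"
  assumes "module R M" "submodule U R M" "submodule V R M"
  shows "U \<subseteq> U <+>\<^bsub>M\<^esub> V"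
proof
  interpret module R M by fact
  note U = submoduleD[OF assms(1,2)] and V = submoduleD[OF assms(1,3)]
  fix x assume "x \<in> U"
  then show "x \<in> U <+>\<^bsub>M\<^esub> V" unfolding set_add_mem using U(3) V(2) by (intro bexI[of _ x] bexI[of _ "\<zero>\<^bsub>M\<^esub>"]) auto
qed

lemma subset_set_add2:
  fixes R :: "'r ring" and M :: "('r,'u) module"
  assumes "module R M" "submodule U R M" "submodule V R M"
  shows "V \<subseteq> U <+>\<^bsub>M\<^esub> V"
proof
  interpret module R M by fact
  note U = submoduleD[OF assms(1,2)] and V = submoduleD[OF assms(1,3)]
  fix x assume "x \<in> V"
  then show "x \<in> U <+>\<^bsub>M\<^esub> V" unfolding set_add_mem using U(2) V(3) by (intro bexI[of _ x] bexI[of _ "\<zero>\<^bsub>M\<^esub>"]) auto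
qed

lemma set_add_least:
  fixes R :: "'r ring" and M :: "('r,'u) module"
  assumes "module R M" "submodule W R M" "U \<subseteq> W" "V \<subseteq> W"
  shows "U <+>\<^bsub>M\<^esub> V \<subseteq> W"
proof
  fix x assume "x \<in> U <+>\<^bsub>M\<^esub> V"
  then obtain u v where "u \<in> U" "v \<in> V" "x = u \<oplus>\<^bsub>M\<^esub> v" unfolding set_add_mem by blast
  then show "x \<in> W" using submoduleD(4)[OF assms(1,2), of u v] assms(3,4) by blast
qed

lemma submodule_image:
  fixes R :: "'r ring" and M :: "('r,'u) module" and M' :: "('r,'v) module"
  assumes "module R M" "module R M'" "f \<in> rhom R M M'" "submodule N R M"
  shows "submodule (f ` N) R M'"
proof -
  note f = rhomD[OF assms(3)] and N = submoduleD[OF assms(1,4)]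
  show ?thesis unfolding submodule_iff[OF assms(2)]
  proof (intro conjI ballI)
    show "\<zero>\<^bsub>M'\<^esub> \<in> f ` N" using rhom_zero[OF assms(1-3)] N(2) by (intro image_eqI) auto
    fix x y assume "x \<in> f ` N" "y \<in> f ` N"
    then obtain u v where "u \<in> N" "v \<in> N" "x = f u" "y = f v" by blast
    then show "x \<oplus>\<^bsub>M'\<^esub> y \<in> f ` N" using f(2)[of u v] N(3,4) by (intro image_eqI[of _ _ "u \<oplus>\<^bsub>M\<^esub> v"]) auto
  next
    fix a x assume "a \<in> carrier R" "x \<in> f ` N"
    then obtain u where "u \<in> N" "x = f u" by blast
    then show "a \<odot>\<^bsub>M'\<^esub> x \<in> f ` N" using f(3)[of a u] N(3,5) \<open>a \<in> carrier R\<close>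
      by (intro image_eqI[of _ _ "a \<odot>\<^bsub>M\<^esub> u"]) auto
  qed (use f(1) N(3) in auto)
qed

lemma submodule_vimage:
  fixes R :: "'r ring" and M :: "('r,'u) module" and M' :: "('r,'v) module"
  assumes "module R M" "module R M'" "f \<in> rhom R M M'" "submodule P R M" "submodule N R M'"
  shows "submodule {v \<in> P. f v \<in> N} R M"
proof -
  note f = rhomD[OF assms(3)] and P = submoduleD[OF assms(1,4)] and N = submoduleD[OF assms(2,5)]
  show ?thesis unfolding submodule_iff[OF assms(1)]
  proof (intro conjI ballI)
    show "{v \<in> P. f v \<in> N} \<subseteq> carrier M" using P(1) by blast
    show "\<zero>\<^bsub>M\<^esub> \<in> {v \<in> P. f v \<in> N}" using P(2) N(2) rhom_zero[OF assms(1-3)] by simp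
    fix x y assume "x \<in> {v \<in> P. f v \<in> N}" "y \<in> {v \<in> P. f v \<in> N}"
    then show "x \<oplus>\<^bsub>M\<^esub> y \<in> {v \<in> P. f v \<in> N}" using f(2)[of x y] P(3,4) N(4) by simp
  next
    fix a x assume "a \<in> carrier R" "x \<in> {v \<in> P. f v \<in> N}"
    then show "a \<odot>\<^bsub>M\<^esub> x \<in> {v \<in> P. f v \<in> N}" using f(3)[of a x] P(3,5) N(5) by simp
  qed
qed

lemma image_rspan:
  fixes R :: "'r ring" and M :: "('r,'u) module" and M' :: "('r,'v) module"
  assumes "module R M" "module R M'" "f \<in> rhom R M M'" "G \<subseteq> carrier M"
  shows "f ` rspan R M G = rspan R M' (f ` G)"
proof
  have "f ` G \<subseteq> carrier M'" using rhomD(1)[OF assms(3)] assms(4) by auto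
  then have "submodule {v \<in> carrier M. f v \<in> rspan R M' (f ` G)} R M"
    by (intro submodule_vimage[OF assms(1-3)] submodule_carrier submodule_rspan assms)
  then have "rspan R M G \<subseteq> {v \<in> carrier M. f v \<in> rspan R M' (f ` G)}"
    by (rule rspan_least) (use assms(4) rspan_superset[of "f ` G" R M'] in blast)
  then show "f ` rspan R M G \<subseteq> rspan R M' (f ` G)" by auto
  show "rspan R M' (f ` G) \<subseteq> f ` rspan R M G"
    by (intro rspan_least submodule_image[OF assms(1-3)] submodule_rspan assms image_mono rspan_superset)
qed

lemma rspan_Un_rspan:
  fixes R :: "'r ring" and M :: "('r,'u) module"
  assumes "module R M" "G \<subseteq> carrier M" "H \<subseteq> carrier M"
  shows "rspan R M (rspan R M G \<union> rspan R M H) = rspan R M (G \<union> H)"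
proof
  show "rspan R M (rspan R M G \<union> rspan R M H) \<subseteq> rspan R M (G \<union> H)"
    by (intro rspan_least submodule_rspan Un_least rspan_mono) (use assms in auto)
  show "rspan R M (G \<union> H) \<subseteq> rspan R M (rspan R M G \<union> rspan R M H)"
    by (intro rspan_mono Un_mono rspan_superset)
qed

lemma rspan_Un_eq_set_add:
  fixes R :: "'r ring" and M :: "('r,'u) module"
  assumes "module R M" "submodule U R M" "submodule V R M"
  shows "rspan R M (U \<union> V) = U <+>\<^bsub>M\<^esub> V"
proof
  show "rspan R M (U \<union> V) \<subseteq> U <+>\<^bsub>M\<^esub> V"
    using subset_set_add1[OF assms] subset_set_add2[OF assms]
    by (intro rspan_least submodule_set_add assms) auto
  show "U <+>\<^bsub>M\<^esub> V \<subseteq> rspan R M (U \<union> V)"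
    using rspan_superset[of "U \<union> V" R M] submoduleD(1)[OF assms(1,2)] submoduleD(1)[OF assms(1,3)]
    by (intro set_add_least[OF assms(1)] submodule_rspan assms) auto
qed

section \<open>Finitely generated submodules and the Noetherian property\<close>

lemma submodule_of_fg: "module R M \<Longrightarrow> fg_rsub R M V \<Longrightarrow> submodule V R M"
  unfolding fg_rsub_def using submodule_rspan by blast

lemma fg_rsub_image:
  fixes R :: "'r ring" and M :: "('r,'u) module" and M' :: "('r,'v) module"
  assumes "module R M" "module R M'" "f \<in> rhom R M M'" "fg_rsub R M V"
  shows "fg_rsub R M' (f ` V)"
proof -
  obtain G where G: "finite G" "G \<subseteq> carrier M" "V = rspan R M G" using assms(4) unfolding fg_rsub_def by blast
  then have "f ` V = rspan R M' (f ` G)" using image_rspan assms by blast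
  then show ?thesis unfolding fg_rsub_def using G rhomD(1)[OF assms(3)] by (intro exI[of _ "f ` G"]) auto
qed

lemma fg_rsub_rsub:
  fixes R :: "'r ring" and M :: "('r,'u) module"
  assumes "module R M" "submodule N R M" "fg_rsub R M V" "V \<subseteq> N"
  shows "fg_rsub R (rsub M N) V"
proof -
  obtain G where G: "finite G" "G \<subseteq> carrier M" "V = rspan R M G" using assms(3) unfolding fg_rsub_def by blast
  then have "G \<subseteq> N" using assms(4) rspan_superset[of G R M] by blast
  then show ?thesis unfolding fg_rsub_def using G rspan_rsub[OF assms(1,2)] by (intro exI[of _ G]) auto
qed

lemma fg_rsub_of_rsub:
  fixes R :: "'r ring" and M :: "('r,'u) module"
  assumes "module R M" "submodule N R M" "fg_rsub R (rsub M N) V"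
  shows "fg_rsub R M V"
proof -
  obtain G where G: "finite G" "G \<subseteq> N" "V = rspan R (rsub M N) G" using assms(3) unfolding fg_rsub_def by auto
  then show ?thesis unfolding fg_rsub_def
    using rspan_rsub[OF assms(1,2), of G] submoduleD(1)[OF assms(1,2)] by (intro exI[of _ G]) auto
qed

text \<open>A finite generating set of the union already lies in one member of the chain.\<close>

lemma fg_chain_stabilizes:
  fixes R :: "'r ring" and M :: "('r,'u) module" and C :: "nat \<Rightarrow> 'u set"
  assumes "module R M" "\<And>j. submodule (C j) R M" "mono C" "fg_rsub R M (\<Union>j. C j)"
  obtains j where "(\<Union>j. C j) = C j"
proof -
  obtain G where G: "finite G" "(\<Union>j. C j) = rspan R M G" using assms(4) unfolding fg_rsub_def by blast
  have "\<exists>j. G' \<subseteq> C j" if "finite G'" "G' \<subseteq> (\<Union>j. C j)" for G'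
    using that
  proof (induction G')
    case (insert x F)
    then obtain i j where "x \<in> C i" "F \<subseteq> C j" by auto
    then have "insert x F \<subseteq> C (max i j)"
      using monoD[OF assms(3), of i "max i j"] monoD[OF assms(3), of j "max i j"] by auto
    then show ?case by blast
  qed auto
  then obtain j where "G \<subseteq> C j" using G rspan_superset[of G R M] by metis
  then have "rspan R M G \<subseteq> C j" by (rule rspan_least[OF assms(2)])
  then show ?thesis using G(2) that by blast
qed

text \<open>The ideal is the preimage, under \<open>a\<close> to \<open>a g\<close>, of the image of
  \<open>N\<close> in the quotient by \<open>W\<close>. With \<open>W\<close> spanned by the other
  generators, it collects the coefficients of \<open>g\<close> in elements of \<open>N\<close>; its
  finite generation is where the Noetherian hypothesis on \<open>R\<close> acts.\<close>

lemma ideal_leading_coefficients: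
  fixes R :: "'r ring" and M :: "('r,'u) module"
  assumes "module R M" "submodule W R M" "submodule N R M" "g \<in> carrier M"
  shows "ideal {a \<in> carrier R. \<exists>w\<in>W. a \<odot>\<^bsub>M\<^esub> g \<oplus>\<^bsub>M\<^esub> w \<in> N} R" (is "ideal ?I R")
proof -
  interpret module R M by fact
  note N = submoduleD[OF assms(1,3)] and W = submoduleD[OF assms(1,2)] and g = assms(4)
  have I_add: "a \<oplus>\<^bsub>R\<^esub> b \<in> ?I" if ab: "a \<in> ?I" "b \<in> ?I" for a b
  proof -
    obtain u v where *: "a \<in> carrier R" "b \<in> carrier R" "u \<in> W" "v \<in> W"
      "a \<odot>\<^bsub>M\<^esub> g \<oplus>\<^bsub>M\<^esub> u \<in> N" "b \<odot>\<^bsub>M\<^esub> g \<oplus>\<^bsub>M\<^esub> v \<in> N" using ab by blast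
    have "(a \<odot>\<^bsub>M\<^esub> g \<oplus>\<^bsub>M\<^esub> u) \<oplus>\<^bsub>M\<^esub> (b \<odot>\<^bsub>M\<^esub> g \<oplus>\<^bsub>M\<^esub> v) = (a \<oplus>\<^bsub>R\<^esub> b) \<odot>\<^bsub>M\<^esub> g \<oplus>\<^bsub>M\<^esub> (u \<oplus>\<^bsub>M\<^esub> v)"
      using * g W(3) by (simp add: smult_l_distr M.a_ac)
    then have "(a \<oplus>\<^bsub>R\<^esub> b) \<odot>\<^bsub>M\<^esub> g \<oplus>\<^bsub>M\<^esub> (u \<oplus>\<^bsub>M\<^esub> v) \<in> N" using N(4)[OF *(5,6)] by simp
    then show ?thesis using * W(4)[OF *(3,4)] by blast
  qed
  have I_mult: "a \<otimes>\<^bsub>R\<^esub> b \<in> ?I" if ab: "a \<in> carrier R" "b \<in> ?I" for a b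
  proof -
    obtain v where *: "b \<in> carrier R" "v \<in> W" "b \<odot>\<^bsub>M\<^esub> g \<oplus>\<^bsub>M\<^esub> v \<in> N" using ab by blast
    have "a \<odot>\<^bsub>M\<^esub> (b \<odot>\<^bsub>M\<^esub> g \<oplus>\<^bsub>M\<^esub> v) = (a \<otimes>\<^bsub>R\<^esub> b) \<odot>\<^bsub>M\<^esub> g \<oplus>\<^bsub>M\<^esub> a \<odot>\<^bsub>M\<^esub> v"
      using * g W(3) ab(1) by (simp add: smult_r_distr smult_assoc1)
    then have "(a \<otimes>\<^bsub>R\<^esub> b) \<odot>\<^bsub>M\<^esub> g \<oplus>\<^bsub>M\<^esub> a \<odot>\<^bsub>M\<^esub> v \<in> N" using N(5)[OF ab(1) *(3)] by simp
    then show ?thesis using * W(5)[OF ab(1) *(2)] ab(1) by blast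
  qed
  have "\<zero>\<^bsub>R\<^esub> \<odot>\<^bsub>M\<^esub> g \<oplus>\<^bsub>M\<^esub> \<zero>\<^bsub>M\<^esub> \<in> N" using N(2) g by simp
  then have I_zero: "\<zero>\<^bsub>R\<^esub> \<in> ?I" using W(2) by blast
  show ?thesis
  proof (rule idealI)
    show "ring R" by unfold_locales
    show "subgroup ?I (add_monoid R)"
    proof (rule R.add.subgroupI)
      fix a assume a: "a \<in> ?I"
      then have "(\<ominus>\<^bsub>R\<^esub> \<one>\<^bsub>R\<^esub>) \<otimes>\<^bsub>R\<^esub> a \<in> ?I" by (intro I_mult) auto
      moreover have "(\<ominus>\<^bsub>R\<^esub> \<one>\<^bsub>R\<^esub>) \<otimes>\<^bsub>R\<^esub> a = \<ominus>\<^bsub>R\<^esub> a" using a by (simp add: R.l_minus)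
      ultimately show "\<ominus>\<^bsub>R\<^esub> a \<in> ?I" by simp
    next
      show "?I \<noteq> {}" using I_zero by blast
    qed (use I_add in blast)+
    fix a x assume ax: "a \<in> ?I" "x \<in> carrier R"
    then show xa: "x \<otimes>\<^bsub>R\<^esub> a \<in> ?I" by (intro I_mult)
    have "a \<otimes>\<^bsub>R\<^esub> x = x \<otimes>\<^bsub>R\<^esub> a" using ax by (intro R.m_comm) auto
    then show "a \<otimes>\<^bsub>R\<^esub> x \<in> ?I" using xa by simp
  qed
qed

lemma rspan_insert_subset:
  fixes R :: "'r ring" and M :: "('r,'u) module"
  assumes "module R M" "g \<in> carrier M" "G \<subseteq> carrier M" "x \<in> rspan R M (insert g G)"
  obtains a w where "a \<in> carrier R" "w \<in> rspan R M G" "x = a \<odot>\<^bsub>M\<^esub> g \<oplus>\<^bsub>M\<^esub> w"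
proof -
  interpret module R M by fact
  let ?U = "(\<lambda>a. a \<odot>\<^bsub>M\<^esub> g) ` carrier R"
  have subU: "submodule ?U R M" unfolding submodule_iff[OF assms(1)]
  proof (intro conjI ballI)
    show "?U \<subseteq> carrier M" using assms by auto
    show "\<zero>\<^bsub>M\<^esub> \<in> ?U" by (intro image_eqI[of _ _ "\<zero>\<^bsub>R\<^esub>"]) (use assms in auto)
    fix x y assume "x \<in> ?U" "y \<in> ?U"
    then obtain a b where "a \<in> carrier R" "b \<in> carrier R" "x = a \<odot>\<^bsub>M\<^esub> g" "y = b \<odot>\<^bsub>M\<^esub> g" by blast
    then show "x \<oplus>\<^bsub>M\<^esub> y \<in> ?U" using assms
      by (intro image_eqI[of _ _ "a \<oplus>\<^bsub>R\<^esub> b"]) (auto simp: smult_l_distr)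
  next
    fix a x assume "a \<in> carrier R" "x \<in> ?U"
    then obtain b where "b \<in> carrier R" "x = b \<odot>\<^bsub>M\<^esub> g" by blast
    then show "a \<odot>\<^bsub>M\<^esub> x \<in> ?U" using assms \<open>a \<in> carrier R\<close>
      by (intro image_eqI[of _ _ "a \<otimes>\<^bsub>R\<^esub> b"]) (auto simp: smult_assoc1)
  qed
  have subW: "submodule (rspan R M G) R M" by (rule submodule_rspan) fact+
  have "g \<in> ?U" by (intro image_eqI[of _ _ "\<one>\<^bsub>R\<^esub>"]) (use assms in auto)
  then have "insert g G \<subseteq> ?U <+>\<^bsub>M\<^esub> rspan R M G"
    using subset_set_add1[OF assms(1) subU subW] subset_set_add2[OF assms(1) subU subW] rspan_superset[of G R M] by blast
  then have "rspan R M (insert g G) \<subseteq> ?U <+>\<^bsub>M\<^esub> rspan R M G"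
    by (rule rspan_least[OF submodule_set_add[OF assms(1) subU subW]])
  then have "x \<in> ?U <+>\<^bsub>M\<^esub> rspan R M G" using assms(4) by blast
  then show ?thesis unfolding set_add_mem using that by blast
qed

text \<open>Induction on the generators of \<open>V\<close>: \<open>N\<close> is generated by
  \<open>N \<inter> ?W\<close>, finitely generated by induction, and by one lift
  \<open>a g + w a\<close> for each of finitely many generators \<open>a\<close> of the coefficient
  ideal.\<close>

lemma fg_rsub_of_noetherian:
  fixes R :: "'r ring" and M :: "('r,'u) module"
  assumes "module R M" "noetherian_ring R" "fg_rsub R M V" "submodule N R M" "N \<subseteq> V"
  shows "fg_rsub R M N"
proof -
  interpret module R M by fact
  obtain G where "finite G" "G \<subseteq> carrier M" "V = rspan R M G" using assms(3) unfolding fg_rsub_def by blast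
  then show ?thesis using assms(4,5)
  proof (induction G arbitrary: V N)
    case empty
    have "rspan R M {} \<subseteq> {\<zero>\<^bsub>M\<^esub>}" by (rule rspan_least[OF submodule_zero]) (use assms in auto)
    then have "N = {\<zero>\<^bsub>M\<^esub>}" using empty submoduleD(2)[OF assms(1) empty(3)] by blast
    then have "N = rspan R M {}" using submoduleD(2)[OF assms(1) submodule_rspan[OF assms(1), of "{}"]]
        \<open>rspan R M {} \<subseteq> {\<zero>\<^bsub>M\<^esub>}\<close> by auto
    then show ?case unfolding fg_rsub_def by blast
  next
    case (insert g G)
    let ?W = "rspan R M G"
    have g: "g \<in> carrier M" and G: "G \<subseteq> carrier M" using insert.prems by auto
    note N = submoduleD[OF assms(1) insert.prems(3)]
    have subW: "submodule ?W R M" using submodule_rspan[OF assms(1)] insert.prems by auto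
    note W = submoduleD[OF assms(1) subW]
    define I where "I N = {a \<in> carrier R. \<exists>w\<in>?W. a \<odot>\<^bsub>M\<^esub> g \<oplus>\<^bsub>M\<^esub> w \<in> N}" for N
    have ideal: "submodule N R M \<Longrightarrow> ideal (I N) R" for N
      unfolding I_def by (intro ideal_leading_coefficients assms subW g)
    then obtain E where E: "E \<subseteq> carrier R" "finite E" "I N = genideal R E"
      using noetherian_ring.finetely_gen[OF assms(2) ideal[OF insert.prems(3)]] by blast
    then have "E \<subseteq> I N" using R.genideal_self[OF E(1)] by simp
    then have "\<forall>a\<in>E. \<exists>w\<in>?W. a \<odot>\<^bsub>M\<^esub> g \<oplus>\<^bsub>M\<^esub> w \<in> N" unfolding I_def by auto
    then obtain w where w: "\<And>a. a \<in> E \<Longrightarrow> w a \<in> ?W" "\<And>a. a \<in> E \<Longrightarrow> a \<odot>\<^bsub>M\<^esub> g \<oplus>\<^bsub>M\<^esub> w a \<in> N" by metis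
    have "fg_rsub R M (N \<inter> ?W)"
      by (rule insert.IH[OF G refl submodule_Int]) (use insert.prems subW assms(1) in auto)
    then obtain F where F: "finite F" "F \<subseteq> carrier M" "N \<inter> ?W = rspan R M F" unfolding fg_rsub_def by blast
    define T where "T = F \<union> (\<lambda>a. a \<odot>\<^bsub>M\<^esub> g \<oplus>\<^bsub>M\<^esub> w a) ` E"
    have "F \<subseteq> N" using F(3) rspan_superset[of F R M] by blast
    then have TN: "T \<subseteq> N" unfolding T_def using w by auto
    have Tc: "T \<subseteq> carrier M" using TN N(1) by blast
    have subT: "submodule (rspan R M T) R M" by (rule submodule_rspan[OF assms(1) Tc])
    note T = submoduleD[OF assms(1) subT]
    have TN': "rspan R M T \<subseteq> N" by (rule rspan_least[OF insert.prems(3) TN])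
    have NW: "N \<inter> ?W \<subseteq> rspan R M T" unfolding F(3) by (rule rspan_mono) (auto simp: T_def)
    have "E \<subseteq> I (rspan R M T)"
    proof
      fix a assume a: "a \<in> E"
      then have "a \<odot>\<^bsub>M\<^esub> g \<oplus>\<^bsub>M\<^esub> w a \<in> rspan R M T" using rspan_superset[of T R M] unfolding T_def by blast
      then show "a \<in> I (rspan R M T)" unfolding I_def using a w(1) E(1) by blast
    qed
    then have IJ: "I N \<subseteq> I (rspan R M T)" unfolding E(3) by (intro R.genideal_minimal ideal subT)
    \<comment> \<open>Some element of the span of \<open>T\<close> has the same coefficient
      \<open>a\<close> as \<open>x\<close>; their difference lies in \<open>N \<inter> ?W\<close>
      and therefore in the span.\<close>
    have "N \<subseteq> rspan R M T"
    proof
      fix x assume x: "x \<in> N"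
      then have "x \<in> rspan R M (insert g G)" using insert.prems by blast
      then obtain a v where a: "a \<in> carrier R" and v: "v \<in> ?W" and xav: "x = a \<odot>\<^bsub>M\<^esub> g \<oplus>\<^bsub>M\<^esub> v"
        using rspan_insert_subset[OF assms(1) g G] by blast
      then have "a \<in> I N" unfolding I_def using x by blast
      then obtain v' where v': "v' \<in> ?W" "a \<odot>\<^bsub>M\<^esub> g \<oplus>\<^bsub>M\<^esub> v' \<in> rspan R M T" using IJ unfolding I_def by blast
      have c: "v \<in> carrier M" "v' \<in> carrier M" "a \<odot>\<^bsub>M\<^esub> g \<in> carrier M" using v v' W(3) a g by auto
      have eq: "x \<ominus>\<^bsub>M\<^esub> (a \<odot>\<^bsub>M\<^esub> g \<oplus>\<^bsub>M\<^esub> v') = v \<ominus>\<^bsub>M\<^esub> v'"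
        unfolding xav a_minus_def using c by (simp add: M.minus_add M.a_ac M.r_neg M.r_neg1 M.r_neg2)
      have "v \<ominus>\<^bsub>M\<^esub> v' \<in> N" using N(7)[OF x, of "a \<odot>\<^bsub>M\<^esub> g \<oplus>\<^bsub>M\<^esub> v'"] v'(2) TN' eq by auto
      then have "v \<ominus>\<^bsub>M\<^esub> v' \<in> rspan R M T" using NW W(7)[OF v v'(1)] by blast
      then have "(v \<ominus>\<^bsub>M\<^esub> v') \<oplus>\<^bsub>M\<^esub> (a \<odot>\<^bsub>M\<^esub> g \<oplus>\<^bsub>M\<^esub> v') \<in> rspan R M T" using T(4) v'(2) by blast
      moreover have "(v \<ominus>\<^bsub>M\<^esub> v') \<oplus>\<^bsub>M\<^esub> (a \<odot>\<^bsub>M\<^esub> g \<oplus>\<^bsub>M\<^esub> v') = x"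
        unfolding xav
      proof -
        have "(v \<ominus>\<^bsub>M\<^esub> v') \<oplus>\<^bsub>M\<^esub> (a \<odot>\<^bsub>M\<^esub> g \<oplus>\<^bsub>M\<^esub> v') = a \<odot>\<^bsub>M\<^esub> g \<oplus>\<^bsub>M\<^esub> ((v \<ominus>\<^bsub>M\<^esub> v') \<oplus>\<^bsub>M\<^esub> v')"
          using c by (simp add: M.a_lcomm)
        also have "(v \<ominus>\<^bsub>M\<^esub> v') \<oplus>\<^bsub>M\<^esub> v' = v" using c by (simp add: a_minus_def M.a_assoc M.l_neg)
        finally show "(v \<ominus>\<^bsub>M\<^esub> v') \<oplus>\<^bsub>M\<^esub> (a \<odot>\<^bsub>M\<^esub> g \<oplus>\<^bsub>M\<^esub> v') = a \<odot>\<^bsub>M\<^esub> g \<oplus>\<^bsub>M\<^esub> v" .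
      qed
      ultimately show "x \<in> rspan R M T" by simp
    qed
    then have "N = rspan R M T" using TN' by blast
    then show ?case unfolding fg_rsub_def using F(1) E(2) Tc by (intro exI[of _ T]) (auto simp: T_def)
  qed
qed

section \<open>Length functions\<close>

text \<open>The carrier consists of coset representatives, so that it stays in the type of \<open>M\<close>.\<close>
lemma exists_quotient_module:
  fixes R :: "'r ring" and M :: "('r,'u) module"
  assumes "module R M" "submodule N R M"
  obtains T :: "('r,'u) module" and g where "module R T" "g \<in> rhom R M T" "g ` carrier M = carrier T"
    "\<And>x. x \<in> carrier M \<Longrightarrow> g x = \<zero>\<^bsub>T\<^esub> \<longleftrightarrow> x \<in> N"
proof -
  interpret module R M by fact
  note N = submoduleD[OF assms]
  have minus_zero: "\<ominus>\<^bsub>M\<^esub> \<zero>\<^bsub>M\<^esub> = \<zero>\<^bsub>M\<^esub>" using M.r_neg[of "\<zero>\<^bsub>M\<^esub>"] by simp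
  define rep where "rep x = (SOME y. y \<in> carrier M \<and> y \<ominus>\<^bsub>M\<^esub> x \<in> N)" for x
  have rep: "rep x \<in> carrier M" "rep x \<ominus>\<^bsub>M\<^esub> x \<in> N" if "x \<in> carrier M" for x
  proof -
    have "x \<in> carrier M \<and> x \<ominus>\<^bsub>M\<^esub> x \<in> N" using that N(2) by (simp add: a_minus_def M.r_neg)
    then have "rep x \<in> carrier M \<and> rep x \<ominus>\<^bsub>M\<^esub> x \<in> N" unfolding rep_def by (rule someI)
    then show "rep x \<in> carrier M" "rep x \<ominus>\<^bsub>M\<^esub> x \<in> N" by auto
  qed
  have diff_trans: "x \<ominus>\<^bsub>M\<^esub> z \<in> N"
    if "x \<ominus>\<^bsub>M\<^esub> y \<in> N" "y \<ominus>\<^bsub>M\<^esub> z \<in> N" "x \<in> carrier M" "y \<in> carrier M" "z \<in> carrier M" for x y z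
  proof -
    have "(x \<ominus>\<^bsub>M\<^esub> y) \<oplus>\<^bsub>M\<^esub> (y \<ominus>\<^bsub>M\<^esub> z) = x \<ominus>\<^bsub>M\<^esub> z"
      using that(3-5) by (simp add: a_minus_def M.a_assoc M.r_neg1 M.r_neg2)
    then show ?thesis using N(4)[OF that(1,2)] by simp
  qed
  have diff_sym: "y \<ominus>\<^bsub>M\<^esub> x \<in> N" if "x \<ominus>\<^bsub>M\<^esub> y \<in> N" "x \<in> carrier M" "y \<in> carrier M" for x y
  proof -
    have "\<ominus>\<^bsub>M\<^esub> (x \<ominus>\<^bsub>M\<^esub> y) = y \<ominus>\<^bsub>M\<^esub> x"
      using that(2-3) by (simp add: a_minus_def M.minus_add M.a_ac)
    then show ?thesis using N(6)[OF that(1)] by simp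
  qed
  \<comment> \<open>Congruent elements define the same predicate, so \<open>SOME\<close> picks the
    same representative: \<open>rep\<close> is constant on cosets.\<close>
  have rep_eq: "rep x = rep y" if "x \<ominus>\<^bsub>M\<^esub> y \<in> N" "x \<in> carrier M" "y \<in> carrier M" for x y
  proof -
    have "(z \<in> carrier M \<and> z \<ominus>\<^bsub>M\<^esub> x \<in> N) = (z \<in> carrier M \<and> z \<ominus>\<^bsub>M\<^esub> y \<in> N)" for z
      using diff_trans[of z x y] diff_trans[of z y x] diff_sym that by blast
    then show ?thesis unfolding rep_def by simp
  qed
  \<comment> \<open>Inserting \<open>rep\<close> into an operand does not change the representative
    of the result. With these rules every module law of \<open>T\<close> reduces to the one of
    \<open>M\<close>.\<close>
  have rep_add1: "rep (rep x \<oplus>\<^bsub>M\<^esub> y) = rep (x \<oplus>\<^bsub>M\<^esub> y)" if "x \<in> carrier M" "y \<in> carrier M" for x y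
  proof (rule rep_eq)
    have "(rep x \<oplus>\<^bsub>M\<^esub> y) \<ominus>\<^bsub>M\<^esub> (x \<oplus>\<^bsub>M\<^esub> y) = rep x \<ominus>\<^bsub>M\<^esub> x"
      using that rep(1)[of x] by (simp add: a_minus_def M.minus_add M.a_comm[of "\<ominus>\<^bsub>M\<^esub> x" "\<ominus>\<^bsub>M\<^esub> y"] M.a_assoc M.r_neg1 M.r_neg2)
    then show "(rep x \<oplus>\<^bsub>M\<^esub> y) \<ominus>\<^bsub>M\<^esub> (x \<oplus>\<^bsub>M\<^esub> y) \<in> N" using rep that by simp
  qed (use that rep in auto)
  have rep_add2: "rep (x \<oplus>\<^bsub>M\<^esub> rep y) = rep (x \<oplus>\<^bsub>M\<^esub> y)" if "x \<in> carrier M" "y \<in> carrier M" for x y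
    using rep_add1[of y x] that rep[of y] by (simp add: M.a_comm)
  have rep_smult: "rep (a \<odot>\<^bsub>M\<^esub> rep x) = rep (a \<odot>\<^bsub>M\<^esub> x)" if "a \<in> carrier R" "x \<in> carrier M" for a x
  proof (rule rep_eq)
    have "a \<odot>\<^bsub>M\<^esub> (rep x \<ominus>\<^bsub>M\<^esub> x) = a \<odot>\<^bsub>M\<^esub> rep x \<ominus>\<^bsub>M\<^esub> a \<odot>\<^bsub>M\<^esub> x"
      using that rep[of x] by (simp add: a_minus_def smult_r_distr smult_r_minus)
    then show "a \<odot>\<^bsub>M\<^esub> rep x \<ominus>\<^bsub>M\<^esub> a \<odot>\<^bsub>M\<^esub> x \<in> N" using N(5)[OF that(1) rep(2)[OF that(2)]] by simp
  qed (use that rep in auto)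
  define T where "T = \<lparr>carrier = rep ` carrier M, mult = (\<lambda>x y. x), one = rep \<zero>\<^bsub>M\<^esub>, zero = rep \<zero>\<^bsub>M\<^esub>,
    add = (\<lambda>x y. rep (x \<oplus>\<^bsub>M\<^esub> y)), module.smult = (\<lambda>a x. rep (a \<odot>\<^bsub>M\<^esub> x))\<rparr>"
  have T [simp]: "carrier T = rep ` carrier M" "\<zero>\<^bsub>T\<^esub> = rep \<zero>\<^bsub>M\<^esub>"
    "\<And>x y. x \<oplus>\<^bsub>T\<^esub> y = rep (x \<oplus>\<^bsub>M\<^esub> y)" "\<And>a x. a \<odot>\<^bsub>T\<^esub> x = rep (a \<odot>\<^bsub>M\<^esub> x)"
    unfolding T_def by auto
  have rep_rep: "rep (rep x) = rep x" if "x \<in> carrier M" for x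
    using rep_eq[OF rep(2)[OF that] rep(1)[OF that] that] .
  have T_sub: "x \<in> carrier M" if "x \<in> carrier T" for x using that rep(1) by auto
  note [simp] = rep_rep rep(1) rep_add1 rep_add2 rep_smult
  show ?thesis
  proof (rule that)
    show "module R T"
    proof (rule moduleI)
      show "cring R" by unfold_locales
      show "abelian_group T"
      proof (rule abelian_groupI)
        fix x assume "x \<in> carrier T"
        then obtain u where u: "u \<in> carrier M" "x = rep u" by auto
        show "\<exists>y\<in>carrier T. y \<oplus>\<^bsub>T\<^esub> x = \<zero>\<^bsub>T\<^esub>"
          by (rule bexI[of _ "rep (\<ominus>\<^bsub>M\<^esub> u)"]) (use u in \<open>auto simp: M.l_neg\<close>)
      next
        fix x y z assume "x \<in> carrier T" "y \<in> carrier T" "z \<in> carrier T"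
        then show "x \<oplus>\<^bsub>T\<^esub> y \<oplus>\<^bsub>T\<^esub> z = x \<oplus>\<^bsub>T\<^esub> (y \<oplus>\<^bsub>T\<^esub> z)"
          by (auto dest!: T_sub simp: M.a_assoc simp del: T(1))
      next
        fix x y assume "x \<in> carrier T" "y \<in> carrier T"
        then show "x \<oplus>\<^bsub>T\<^esub> y = y \<oplus>\<^bsub>T\<^esub> x"
          by (auto dest!: T_sub simp: M.a_comm simp del: T(1))
      qed auto
    next
      fix a b x assume "a \<in> carrier R" "b \<in> carrier R" "x \<in> carrier T"
      then show "(a \<oplus>\<^bsub>R\<^esub> b) \<odot>\<^bsub>T\<^esub> x = a \<odot>\<^bsub>T\<^esub> x \<oplus>\<^bsub>T\<^esub> b \<odot>\<^bsub>T\<^esub> x"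
        "(a \<otimes>\<^bsub>R\<^esub> b) \<odot>\<^bsub>T\<^esub> x = a \<odot>\<^bsub>T\<^esub> (b \<odot>\<^bsub>T\<^esub> x)"
        by (auto dest!: T_sub simp: smult_l_distr smult_assoc1 simp del: T(1))
    qed (auto simp: smult_r_distr)
    show "rep \<in> rhom R M T" unfolding rhom_def by auto
    show "rep ` carrier M = carrier T" by simp
    fix x assume x: "x \<in> carrier M"
    show "rep x = \<zero>\<^bsub>T\<^esub> \<longleftrightarrow> x \<in> N"
    proof
      assume "rep x = \<zero>\<^bsub>T\<^esub>"
      then have *: "rep x = rep \<zero>\<^bsub>M\<^esub>" by simp
      have "rep \<zero>\<^bsub>M\<^esub> \<in> N" using rep[of "\<zero>\<^bsub>M\<^esub>"] by (simp add: a_minus_def minus_zero)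
      moreover have "x \<ominus>\<^bsub>M\<^esub> rep x \<in> N" using rep[OF x] diff_sym x by blast
      ultimately have "(x \<ominus>\<^bsub>M\<^esub> rep x) \<oplus>\<^bsub>M\<^esub> rep x \<in> N" using N(4) * by simp
      moreover have "(x \<ominus>\<^bsub>M\<^esub> rep x) \<oplus>\<^bsub>M\<^esub> rep x = x" using x by (simp add: a_minus_def M.a_assoc M.l_neg)
      ultimately show "x \<in> N" by simp
    next
      assume "x \<in> N"
      then show "rep x = \<zero>\<^bsub>T\<^esub>" using x by (simp, intro rep_eq) (auto simp: a_minus_def minus_zero)
    qed
  qed
qed

lemma length_functionD:
  assumes "length_function R lam"
  shows "\<And>M. module R M \<Longrightarrow> carrier M = {\<zero>\<^bsub>M\<^esub>} \<Longrightarrow> lam M = 0"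
    "\<And>M N. module R M \<Longrightarrow> module R N \<Longrightarrow> riso R M N \<Longrightarrow> lam M = lam N"
    "\<And>A B C f g. module R A \<Longrightarrow> module R B \<Longrightarrow> module R C \<Longrightarrow> short_exact R A B C f g \<Longrightarrow> lam B = lam A + lam C"
    "\<And>M. module R M \<Longrightarrow> lam M = (SUP N \<in> {N. fg_rsub R M N}. lam (rsub M N))"
  using assms unfolding length_function_def by blast+

context
  fixes R :: "'r ring" and lam :: "('r,'u) module \<Rightarrow> ennreal"
  assumes lam: "length_function R lam"
begin

text \<open>The image of \<open>P\<close> plays the role of the quotient by the kernel, so
  additivity applies directly.\<close>

lemma length_hom:
  assumes "module R M" "module R M'" "f \<in> rhom R M M'" "submodule P R M"
  shows "lam (rsub M P) = lam (rsub M {v \<in> P. f v = \<zero>\<^bsub>M'\<^esub>}) + lam (rsub M' (f ` P))"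
proof -
  have K: "submodule {v \<in> P. f v = \<zero>\<^bsub>M'\<^esub>} R M"
    using submodule_vimage[OF assms submodule_zero[OF assms(2)]] by simp
  note f = rhomD[OF assms(3)] and P = submoduleD[OF assms(1,4)]
  show ?thesis
  proof (rule length_functionD(3)[OF lam])
    show "module R (rsub M {v \<in> P. f v = \<zero>\<^bsub>M'\<^esub>})" "module R (rsub M P)" "module R (rsub M' (f ` P))"
      by (intro module_rsub submodule_image[OF assms] K assms)+
    show "short_exact R (rsub M {v \<in> P. f v = \<zero>\<^bsub>M'\<^esub>}) (rsub M P) (rsub M' (f ` P)) id f"
      unfolding short_exact_def rhom_def using f P(3) by auto
  qed
qed

lemma length_inj:
  assumes "module R M" "module R M'" "f \<in> rhom R M M'" "inj_on f (carrier M)" "submodule P R M"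
  shows "lam (rsub M' (f ` P)) = lam (rsub M P)"
proof (rule sym, rule length_functionD(2)[OF lam])
  show "module R (rsub M P)" "module R (rsub M' (f ` P))"
    by (intro module_rsub submodule_image[OF assms(1-3)] assms)+
  show "riso R (rsub M P) (rsub M' (f ` P))"
    unfolding riso_def
  proof (rule bexI[of _ f])
    show "bij_betw f (carrier (rsub M P)) (carrier (rsub M' (f ` P)))"
      using inj_on_subset[OF assms(4) submoduleD(1)[OF assms(1,5)]] by (simp add: bij_betw_def)
    show "f \<in> rhom R (rsub M P) (rsub M' (f ` P))"
      using rhomD[OF assms(3)] submoduleD(3)[OF assms(1,5)] unfolding rhom_def by auto
  qed
qed

text \<open>Read off from the supremum over finitely generated submodules: those of \<open>U\<close>
  are among those of \<open>V\<close>.\<close>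

lemma length_mono:
  assumes "module R M" "submodule U R M" "submodule V R M" "U \<subseteq> V"
  shows "lam (rsub M U) \<le> lam (rsub M V)"
proof -
  have "lam (rsub M U) = (SUP N \<in> {N. fg_rsub R (rsub M U) N}. lam (rsub M N))"
    using length_functionD(4)[OF lam module_rsub[OF assms(1,2)]] by simp
  also have "\<dots> \<le> (SUP N \<in> {N. fg_rsub R (rsub M V) N}. lam (rsub M N))"
  proof (rule SUP_subset_mono)
    show "{N. fg_rsub R (rsub M U) N} \<subseteq> {N. fg_rsub R (rsub M V) N}"
    proof clarify
      fix N assume N: "fg_rsub R (rsub M U) N"
      then have "N \<subseteq> U" using submodule_of_fg[OF module_rsub[OF assms(1,2)]] submodule_rsub_iff[OF assms(1,2)] by blast
      then show "fg_rsub R (rsub M V) N"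
        using fg_rsub_of_rsub[OF assms(1,2) N] fg_rsub_rsub[OF assms(1,3)] assms(4) by blast
    qed
  qed simp
  also have "\<dots> = lam (rsub M V)" using length_functionD(4)[OF lam module_rsub[OF assms(1,3)]] by simp
  finally show ?thesis .
qed

text \<open>In the quotient by \<open>V\<close>, the sum and \<open>U\<close> have the same image,
  with kernels \<open>V\<close> and \<open>U \<inter> V\<close>. The additive form avoids
  subtraction in \<open>ennreal\<close>.\<close>

lemma length_modular:
  assumes "module R M" "submodule U R M" "submodule V R M"
  shows "lam (rsub M (U <+>\<^bsub>M\<^esub> V)) + lam (rsub M (U \<inter> V)) = lam (rsub M U) + lam (rsub M V)"
proof -
  interpret module R M by fact
  let ?W = "U <+>\<^bsub>M\<^esub> V"
  note U = submoduleD[OF assms(1,2)] and V = submoduleD[OF assms(1,3)]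
  have W: "submodule ?W R M" by (intro submodule_set_add assms)
  obtain T :: "('r,'u) module" and g where T: "module R T" "g \<in> rhom R M T" "\<And>x. x \<in> carrier M \<Longrightarrow> g x = \<zero>\<^bsub>T\<^esub> \<longleftrightarrow> x \<in> V"
    using exists_quotient_module[OF assms(1,3)] by metis
  interpret T: module R T by fact
  note g = rhomD[OF T(2)]
  have "g ` ?W = g ` U"
  proof
    show "g ` U \<subseteq> g ` ?W" using subset_set_add1[OF assms] by blast
    show "g ` ?W \<subseteq> g ` U"
    proof
      fix y assume "y \<in> g ` ?W"
      then obtain u v where uv: "u \<in> U" "v \<in> V" "y = g (u \<oplus>\<^bsub>M\<^esub> v)" by (auto simp: set_add_mem)
      have "g v = \<zero>\<^bsub>T\<^esub>" using T(3) uv V(3) by blast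
      then have "y = g u" using uv g(1,2) U(3) V(3) by simp
      then show "y \<in> g ` U" using uv by blast
    qed
  qed
  moreover have "{v \<in> ?W. g v = \<zero>\<^bsub>T\<^esub>} = V"
    using T(3) subset_set_add2[OF assms] submoduleD(3)[OF assms(1) W] by blast
  moreover have "{v \<in> U. g v = \<zero>\<^bsub>T\<^esub>} = U \<inter> V" using T(3) U(3) by blast
  ultimately have "lam (rsub M ?W) = lam (rsub M V) + lam (rsub T (g ` U))"
    "lam (rsub M U) = lam (rsub M (U \<inter> V)) + lam (rsub T (g ` U))"
    using length_hom[OF assms(1) T(1,2) W] length_hom[OF assms(1) T(1,2) assms(2)] by simp_all
  then show ?thesis by (simp add: ac_simps)
qed

text \<open>Cyclic submodules have finite length by hypothesis, and length is subadditive on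
  sums.\<close>

lemma length_fg_finite:
  assumes "module R M" "loc_finite R lam M" "fg_rsub R M V"
  shows "lam (rsub M V) < \<infinity>"
proof -
  interpret module R M by fact
  obtain G where "finite G" "G \<subseteq> carrier M" "V = rspan R M G" using assms(3) unfolding fg_rsub_def by blast
  then show ?thesis
  proof (induction G arbitrary: V)
    case empty
    have "rspan R M {} = {\<zero>\<^bsub>M\<^esub>}"
      using rspan_least[OF submodule_zero[OF assms(1)], of "{}"]
        submoduleD(2)[OF assms(1) submodule_rspan[OF assms(1), of "{}"]] by auto
    then have "lam (rsub M V) = 0"
      using empty by (intro length_functionD(1)[OF lam] module_rsub assms) (auto simp: submodule_zero assms)
    then show ?case by simp
  next
    case (insert g G)
    let ?U = "rspan R M {g}" and ?W = "rspan R M G"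
    have UW: "submodule ?U R M" "submodule ?W R M" using submodule_rspan[OF assms(1)] insert.prems by auto
    have "V = ?U <+>\<^bsub>M\<^esub> ?W"
      using rspan_Un_eq_set_add[OF assms(1) UW] rspan_Un_rspan[OF assms(1), of "{g}" G] insert.prems by auto
    then have "lam (rsub M V) \<le> lam (rsub M ?U) + lam (rsub M ?W)"
      using length_modular[OF assms(1) UW] by (metis le_add1 le_iff_add)
    also have "\<dots> < \<infinity>"
      using insert assms(2) unfolding loc_finite_def by simp
    finally show ?case .
  qed
qed

end

section \<open>Graded modules and Hilbert polynomials\<close>

text \<open>The degree is carried by the index alone: components lie in one module and may overlap,
  and each variable is a single endomorphism used in all degrees. This is why a filtration can
  itself be a graded module, with the identity as one of the variables.\<close>

definition graded_sub :: "'r ring \<Rightarrow> nat \<Rightarrow> ('r,'u) module \<Rightarrow> (nat \<Rightarrow> 'u \<Rightarrow> 'u) \<Rightarrow> (nat \<Rightarrow> 'u set) \<Rightarrow> bool" where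
  "graded_sub R m M Y N \<longleftrightarrow> (\<forall>n. submodule (N n) R M \<and> (\<forall>i<m. Y i ` N n \<subseteq> N (Suc n)))"

text \<open>Finite generation of the graded module with components \<open>P n / Q n\<close> over \<open>m\<close> variables,
  provided that every component is finitely generated over \<open>R\<close>.\<close>
definition graded_fg :: "'r ring \<Rightarrow> nat \<Rightarrow> ('r,'u) module \<Rightarrow> (nat \<Rightarrow> 'u \<Rightarrow> 'u) \<Rightarrow> (nat \<Rightarrow> 'u set) \<Rightarrow> (nat \<Rightarrow> 'u set) \<Rightarrow> bool" where
  "graded_fg R m M Y P Q \<longleftrightarrow>
     (\<forall>\<^sub>F n in sequentially. P (Suc n) \<subseteq> rspan R M (Q (Suc n) \<union> (\<Union>i<m. Y i ` P n)))"

lemma smoduleD: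
  assumes "smodule R k M X"
  shows "module R M" "\<And>i. i < k \<Longrightarrow> X i \<in> rhom R M M"
    "\<And>i j v. i < k \<Longrightarrow> j < k \<Longrightarrow> v \<in> carrier M \<Longrightarrow> X i (X j v) = X j (X i v)"
  using assms unfolding smodule_def by auto

lemma smodule_mono: "smodule R k M X \<Longrightarrow> l \<le> k \<Longrightarrow> smodule R l M X"
  unfolding smodule_def by auto

lemma graded_subD:
  assumes "graded_sub R m M Y N"
  shows "submodule (N n) R M" "\<And>i v. i < m \<Longrightarrow> v \<in> N n \<Longrightarrow> Y i v \<in> N (Suc n)"
  using assms unfolding graded_sub_def by blast+

lemma graded_subI:
  assumes "\<And>n. submodule (N n) R M" "\<And>n i v. i < m \<Longrightarrow> v \<in> N n \<Longrightarrow> Y i v \<in> N (Suc n)"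
  shows "graded_sub R m M Y N"
  using assms unfolding graded_sub_def by blast

lemma graded_sub_mono: "graded_sub R m M Y N \<Longrightarrow> l \<le> m \<Longrightarrow> graded_sub R l M Y N"
  unfolding graded_sub_def by auto

lemma rhom_funpow:
  assumes "y \<in> rhom R M M"
  shows "(y ^^ j) \<in> rhom R M M"
  using assms by (induction j) (auto simp: rhom_def Pi_iff)

lemma rhom_funpow_commute:
  assumes "x \<in> rhom R M M" "y \<in> rhom R M M" "\<And>v. v \<in> carrier M \<Longrightarrow> x (y v) = y (x v)" "v \<in> carrier M"
  shows "x ((y ^^ j) v) = (y ^^ j) (x v)"
proof (induction j)
  case (Suc j)
  have "(y ^^ j) v \<in> carrier M" using rhomD(1)[OF rhom_funpow[OF assms(2)] assms(4)] .
  then show ?case using Suc assms(3) by simp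
qed simp

lemma image_set_add_subset:
  assumes "f \<in> rhom R M M'" "U \<subseteq> carrier M" "V \<subseteq> carrier M" "f ` U \<subseteq> U'" "f ` V \<subseteq> V'"
    "x \<in> U <+>\<^bsub>M\<^esub> V"
  shows "f x \<in> U' <+>\<^bsub>M'\<^esub> V'"
proof -
  obtain u v where uv: "u \<in> U" "v \<in> V" "x = u \<oplus>\<^bsub>M\<^esub> v" using assms(6) by (auto simp: set_add_mem)
  then have "f x = f u \<oplus>\<^bsub>M'\<^esub> f v" using rhomD(2)[OF assms(1)] assms(2,3) by auto
  then show ?thesis unfolding set_add_mem using uv assms(4,5) by blast
qed

text \<open>For the last variable \<open>y\<close>, the submodules
  \<open>D j n\<close> of leading forms of elements of \<open>N\<close> along the filtration of \<open>P\<close> by powers of \<open>y\<close>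
  increase with \<open>j\<close> and live on \<open>P / y P\<close>, where \<open>y\<close> acts as zero.\<close>
lemma graded_hilbert_basis:
  fixes R :: "'r ring" and M :: "('r,'u) module"
  assumes "noetherian_ring R" "smodule R m M Y" "graded_sub R m M Y P" "graded_sub R m M Y Q"
    "graded_sub R m M Y N" "\<And>n. fg_rsub R M (P n)" "\<And>n. Q n \<subseteq> N n" "\<And>n. N n \<subseteq> P n" "graded_fg R m M Y P Q"
  shows "graded_fg R m M Y N Q"
  using assms(2-)
proof (induction m arbitrary: P Q N)
  case 0
  have "\<forall>\<^sub>F n in sequentially. P (Suc n) \<subseteq> rspan R M (Q (Suc n))"
    using "0.prems"(8) unfolding graded_fg_def by simp
  then show ?case unfolding graded_fg_def
    by eventually_elim (use "0.prems"(7) in auto)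
next
  case (Suc m)
  note prems = Suc.prems
  note sm = smoduleD[OF prems(1)]
  note md = sm(1)
  interpret module R M by (rule md)
  define y where "y = Y m"
  have y: "y \<in> rhom R M M" unfolding y_def by (intro sm) simp
  note yj = rhom_funpow[OF y]
  note yc = rhomD(1)[OF y] and yjc = rhomD(1)[OF yj]
  have comm: "Y i ((y ^^ j) v) = (y ^^ j) (Y i v)" if "i < Suc m" "v \<in> carrier M" for i j v
    by (rule rhom_funpow_commute[OF sm(2)[OF that(1)] y]) (use that sm(3) in \<open>auto simp: y_def\<close>)
  note P = graded_subD[OF prems(2)] and Q = graded_subD[OF prems(3)] and N = graded_subD[OF prems(4)]
  note PD = submoduleD[OF md P(1)] and QD = submoduleD[OF md Q(1)] and ND = submoduleD[OF md N(1)]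
  have yQ: "y v \<in> Q (Suc n)" if "v \<in> Q n" for v n using Q(2)[of m] that unfolding y_def by simp
  have yP: "y v \<in> P (Suc n)" if "v \<in> P n" for v n using P(2)[of m] that unfolding y_def by simp
  have yN: "y v \<in> N (Suc n)" if "v \<in> N n" for v n using N(2)[of m] that unfolding y_def by simp
  \<comment> \<open>\<open>F j\<close> is the filtration of \<open>P\<close> by powers of
    \<open>y\<close>, enlarged by \<open>Q\<close>. It starts at \<open>P\<close> and in degree
    \<open>n\<close> has come down to \<open>Q\<close> once \<open>j\<close> exceeds
    \<open>n\<close>; this finiteness in each degree ends the last induction of the proof.\<close>
  define F where "F j n = (if j \<le> n then (y ^^ j) ` P (n - j) <+>\<^bsub>M\<^esub> Q n else Q n)" for j n
  have yPsub: "submodule ((y ^^ j) ` P n) R M" for j n by (rule submodule_image[OF md md yj P(1)])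
  have Fsub: "submodule (F j n) R M" for j n
    unfolding F_def using submodule_set_add[OF md yPsub Q(1)] Q(1) by simp
  note FD = submoduleD[OF md Fsub]
  have QF: "Q n \<subseteq> F j n" for j n
    unfolding F_def using subset_set_add2[OF md yPsub Q(1)] by simp
  have YF: "Y i v \<in> F j (Suc n)" if i: "i < Suc m" and v: "v \<in> F j n" for i j n v
  proof (cases "j \<le> n")
    case True
    have "Y i v \<in> (y ^^ j) ` P (Suc n - j) <+>\<^bsub>M\<^esub> Q (Suc n)"
    proof (rule image_set_add_subset[OF sm(2)[OF i]])
      show "Y i ` (y ^^ j) ` P (n - j) \<subseteq> (y ^^ j) ` P (Suc n - j)"
        using comm[OF i] PD(3) P(2)[OF i, of _ "n - j"] True by (auto simp: Suc_diff_le)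
      show "Y i ` Q n \<subseteq> Q (Suc n)" using Q(2)[OF i] by auto
      show "v \<in> (y ^^ j) ` P (n - j) <+>\<^bsub>M\<^esub> Q n" using v True by (simp add: F_def)
    qed (use submoduleD(1)[OF md yPsub] QD(1) in auto)
    then show ?thesis using True by (simp add: F_def)
  next
    case False
    then have "Y i v \<in> Q (Suc n)" using v Q(2)[OF i] by (simp add: F_def)
    then show ?thesis using QF by blast
  qed
  have yF: "y v \<in> F (Suc j) (Suc n)" if v: "v \<in> F j n" for j n v
  proof (cases "j \<le> n")
    case True
    have "y v \<in> (y ^^ Suc j) ` P (n - j) <+>\<^bsub>M\<^esub> Q (Suc n)"
    proof (rule image_set_add_subset[OF y])
      show "v \<in> (y ^^ j) ` P (n - j) <+>\<^bsub>M\<^esub> Q n" using v True by (simp add: F_def)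
    qed (use submoduleD(1)[OF md yPsub] QD(1) yQ in \<open>auto simp: image_image\<close>)
    then show ?thesis using True by (simp add: F_def)
  qed (use v yQ in \<open>auto simp: F_def\<close>)
  have yjF: "(y ^^ j) v \<in> F (Suc j) (n + j)" if v: "v \<in> F 1 n" for j n v
    using v by (induction j) (auto dest: yF)
  have QP: "Q n \<subseteq> P n" for n using prems(6,7) by blast
  have F1P: "F 1 n \<subseteq> P n" for n
  proof -
    have "y ` P (n - 1) \<subseteq> P n" if "1 \<le> n" using yP[of _ "n - 1"] that by auto
    then show ?thesis unfolding F_def using set_add_least[OF md P(1), of "y ` P (n - 1)" n "Q n"] QP[of n] by simp
  qed
  have F0: "F 0 n = P n" for n
  proof -
    have "P n <+>\<^bsub>M\<^esub> Q n \<subseteq> P n" by (intro set_add_least[OF md P(1)] QP order_refl)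
    then show ?thesis unfolding F_def using subset_set_add1[OF md P(1) Q(1), of n n] by auto
  qed
  define A where "A j n = N n <+>\<^bsub>M\<^esub> F j n" for j n
  have Asub: "submodule (A j n) R M" for j n unfolding A_def by (intro submodule_set_add md N(1) Fsub)
  note AD = submoduleD[OF md Asub]
  have FA: "F j n \<subseteq> A j n" for j n unfolding A_def by (rule subset_set_add2[OF md N(1) Fsub])
  have NA: "N n \<subseteq> A j n" for j n unfolding A_def by (rule subset_set_add1[OF md N(1) Fsub])
  have YA: "Y i v \<in> A j (Suc n)" if i: "i < Suc m" and v: "v \<in> A j n" for i j n v
    unfolding A_def
    by (rule image_set_add_subset[OF sm(2)[OF i] ND(1) FD(1) _ _ v[unfolded A_def]]) (use i N(2) YF in auto)
  have yA: "y v \<in> A (Suc j) (Suc n)" if v: "v \<in> A j n" for j n v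
    unfolding A_def
    by (rule image_set_add_subset[OF y ND(1) FD(1) _ _ v[unfolded A_def]]) (use yN yF in auto)
  \<comment> \<open>The condition says that y^j v becomes an element of \<open>N\<close> after
    subtracting something in \<open>F (Suc j)\<close>, that is, terms of higher order in
    \<open>y\<close> or from \<open>Q\<close>.\<close>
  define D where "D j n = {v \<in> P n. (y ^^ j) v \<in> A (Suc j) (n + j)}" for j n
  have Dsub: "submodule (D j n) R M" for j n
    unfolding D_def by (rule submodule_vimage[OF md md yj P(1) Asub])
  have Dgr: "graded_sub R m M Y (D j)" for j
  proof (rule graded_subI[OF Dsub])
    fix n i v assume i: "i < m" and v: "v \<in> D j n"
    then have "Y i ((y ^^ j) v) \<in> A (Suc j) (Suc (n + j))" by (intro YA) (auto simp: D_def)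
    moreover have "v \<in> carrier M" using v PD(3) by (auto simp: D_def)
    ultimately show "Y i v \<in> D j (Suc n)" using comm[of i v j] i v P(2)[of i v n] by (simp add: D_def)
  qed
  have FD1: "F 1 n \<subseteq> D j n" for j n
    unfolding D_def using F1P yjF FA by blast
  have DP: "D j n \<subseteq> P n" for j n unfolding D_def by blast
  \<comment> \<open>Multiplication by \<open>y\<close> keeps the corrected element in
    \<open>N\<close> and raises the order of the correction by one.\<close>
  have Dmono: "mono (\<lambda>j. D j n)" for n
  proof (rule mono_iff_le_Suc[THEN iffD2], intro allI subsetI)
    fix j v assume "v \<in> D j n"
    then show "v \<in> D (Suc j) n" using yA[of "(y ^^ j) v" "Suc j" "n + j"] by (simp add: D_def)
  qed
  have sm': "smodule R m M Y" by (rule smodule_mono[OF prems(1)]) simp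
  have Pgr: "graded_sub R m M Y P" by (rule graded_sub_mono[OF prems(2)]) simp
  have Fgr: "graded_sub R m M Y (F 1)" by (rule graded_subI[OF Fsub]) (rule YF, auto)
  \<comment> \<open>Modulo \<open>F 1\<close> the images under \<open>y\<close> vanish, so the
    remaining \<open>m\<close> variables generate \<open>P\<close>.\<close>
  have PF: "graded_fg R m M Y P (F 1)"
    using prems(8) unfolding graded_fg_def
  proof eventually_elim
    case (elim n)
    let ?S = "rspan R M (F 1 (Suc n) \<union> (\<Union>i<m. Y i ` P n))"
    have "y ` P n \<subseteq> F 1 (Suc n)"
      unfolding F_def using subset_set_add1[OF md yPsub Q(1), of 1 n "Suc n"] by simp
    then have "Q (Suc n) \<union> (\<Union>i<Suc m. Y i ` P n) \<subseteq> F 1 (Suc n) \<union> (\<Union>i<m. Y i ` P n)"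
      using QF[of "Suc n" 1] unfolding y_def lessThan_Suc by blast
    then have "rspan R M (Q (Suc n) \<union> (\<Union>i<Suc m. Y i ` P n)) \<subseteq> ?S" by (rule rspan_mono)
    then show ?case using elim by blast
  qed
  note IH = Suc.IH[OF sm' Pgr Fgr _ prems(5) _ _ PF]
  have Dfg: "graded_fg R m M Y (D j) (F 1)" for j by (rule IH[OF Dgr FD1 DP])
  define U where "U n = (\<Union>j. D j n)" for n
  have Usub: "submodule (U n) R M" for n unfolding U_def by (rule submodule_UN_chain[OF md Dsub Dmono])
  have Ugr: "graded_sub R m M Y U"
    by (rule graded_subI[OF Usub]) (use graded_subD(2)[OF Dgr] in \<open>unfold U_def, blast\<close>)
  have FU: "F 1 n \<subseteq> U n" for n unfolding U_def using FD1[of n 0] by blast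
  have UP: "U n \<subseteq> P n" for n unfolding U_def by (rule UN_least[OF DP])
  have "graded_fg R m M Y U (F 1)" by (rule IH[OF Ugr FU UP])
  then obtain n1 where n1: "\<And>n. n \<ge> n1 \<Longrightarrow> U (Suc n) \<subseteq> rspan R M (F 1 (Suc n) \<union> (\<Union>i<m. Y i ` U n))"
    unfolding graded_fg_def eventually_sequentially by blast
  \<comment> \<open>In a single degree the chain stabilizes, since \<open>P n\<close> is finitely
    generated over a Noetherian ring.\<close>
  have "\<exists>j. U n = D j n" for n
  proof -
    have "fg_rsub R M (\<Union>j. D j n)"
      by (rule fg_rsub_of_noetherian[OF md assms(1) prems(5)[of n]]) (use Usub UP in \<open>auto simp: U_def\<close>)
    then obtain j where "(\<Union>j. D j n) = D j n" by (rule fg_chain_stabilizes[OF md Dsub Dmono])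
    then show ?thesis unfolding U_def by blast
  qed
  then obtain jn where jn: "\<And>n. U n = D (jn n) n" by metis
  \<comment> \<open>Up to degree \<open>n1\<close> there are only finitely many stabilization
    indices. Above \<open>n1\<close> the union is generated from lower degrees modulo
    \<open>F 1\<close>, so their maximum works in every degree.\<close>
  define j0 where "j0 = Max (jn ` {..n1})"
  have Ustable: "U n = D j0 n" for n
  proof (cases "n \<le> n1")
    case True
    then have "jn n \<le> j0" unfolding j0_def by (intro Max_ge) auto
    then have "D (jn n) n \<subseteq> D j0 n" using Dmono by (auto simp: mono_def)
    then show ?thesis using jn[of n] unfolding U_def by blast
  next
    case False
    then have "n1 \<le> n" by simp
    then show ?thesis
    proof (induction n rule: dec_induct)
      case base
      have "jn n1 \<le> j0" unfolding j0_def by (intro Max_ge) auto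
      then have "D (jn n1) n1 \<subseteq> D j0 n1" using Dmono by (auto simp: mono_def)
      then show ?case using jn[of n1] unfolding U_def by blast
    next
      case (step n)
      have "rspan R M (F 1 (Suc n) \<union> (\<Union>i<m. Y i ` D j0 n)) \<subseteq> D j0 (Suc n)"
        by (rule rspan_least[OF Dsub]) (use FD1 graded_subD(2)[OF Dgr] in auto)
      then have "U (Suc n) \<subseteq> D j0 (Suc n)" using n1[OF step.hyps(1)] step.IH by auto
      then show ?case unfolding U_def by blast
    qed
  qed
  \<comment> \<open>By stability only the orders up to \<open>j0\<close> have to be controlled, so
    one degree bound serves all of them.\<close>
  have "\<exists>n2. \<forall>j\<le>j0. \<forall>n\<ge>n2. D j (Suc n) \<subseteq> rspan R M (F 1 (Suc n) \<union> (\<Union>i<m. Y i ` D j n))"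
  proof -
    have "\<forall>\<^sub>F n in sequentially. \<forall>j\<in>{..j0}. D j (Suc n) \<subseteq> rspan R M (F 1 (Suc n) \<union> (\<Union>i<m. Y i ` D j n))"
      using Dfg unfolding graded_fg_def by (intro eventually_ball_finite) auto
    then show ?thesis unfolding eventually_sequentially by (auto simp: Ball_def)
  qed
  then obtain n2 where n2: "\<And>j n. j \<le> j0 \<Longrightarrow> n \<ge> n2 \<Longrightarrow>
      D j (Suc n) \<subseteq> rspan R M (F 1 (Suc n) \<union> (\<Union>i<m. Y i ` D j n))" by blast
  \<comment> \<open>The offset \<open>j0\<close> ensures \<open>n - j \<ge> n2\<close> for every
    \<open>j \<le> j0\<close>: a leading form of order \<open>j\<close> in degree
    \<open>n + 1\<close> comes from an element \<open>w\<close> of degree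
    \<open>n + 1 - j\<close>.\<close>
  have "N (Suc n) \<subseteq> rspan R M (Q (Suc n) \<union> (\<Union>i<Suc m. Y i ` N n))" if n: "n \<ge> n2 + j0" for n
  proof -
    let ?G = "Q (Suc n) \<union> (\<Union>i<Suc m. Y i ` N n)"
    define T where "T = rspan R M ?G"
    have Gc: "?G \<subseteq> N (Suc n)" using prems(6) N(2) by blast
    have Tsub: "submodule T R M" unfolding T_def by (rule submodule_rspan[OF md]) (use Gc ND(1) in blast)
    note TD = submoduleD[OF md Tsub]
    have TN: "T \<subseteq> N (Suc n)" unfolding T_def by (rule rspan_least[OF N(1) Gc])
    have GT: "?G \<subseteq> T" unfolding T_def by (rule rspan_superset)
    have YT: "Y i v \<in> T" if "i < Suc m" "v \<in> N n" for i v using that GT by blast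
    have TFsub: "submodule (T <+>\<^bsub>M\<^esub> F j (Suc n)) R M" for j by (intro submodule_set_add md Tsub Fsub)
    have TTF: "T \<subseteq> T <+>\<^bsub>M\<^esub> F j (Suc n)" for j by (rule subset_set_add1[OF md Tsub Fsub])
    have FTF: "F j (Suc n) \<subseteq> T <+>\<^bsub>M\<^esub> F j (Suc n)" for j by (rule subset_set_add2[OF md Tsub Fsub])
    have YA_TF: "Y i v \<in> T <+>\<^bsub>M\<^esub> F j (Suc n)" if i: "i < Suc m" and v: "v \<in> A j n" for i j v
      by (rule image_set_add_subset[OF sm(2)[OF i] ND(1) FD(1) _ _ v[unfolded A_def]])
        (use i YT YF in auto)
    have yA_TF: "y v \<in> T <+>\<^bsub>M\<^esub> F (Suc j) (Suc n)" if v: "v \<in> A j n" for j v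
      by (rule image_set_add_subset[OF y ND(1) FD(1) _ _ v[unfolded A_def]])
        (use YT yF in \<open>auto simp: y_def\<close>)
    \<comment> \<open>The leading form is removed by elements of \<open>T\<close>, so that modulo
      \<open>T\<close> the order in \<open>y\<close> increases by one.\<close>
    have step: "v \<in> T <+>\<^bsub>M\<^esub> F (Suc j) (Suc n)" if vN: "v \<in> N (Suc n)" and vF: "v \<in> F j (Suc n)" for v j
    proof (cases "j \<le> Suc n")
      case False
      then have "v \<in> Q (Suc n)" using vF by (simp add: F_def)
      then show ?thesis using GT TTF by blast
    next
      case True
      then obtain w q where w: "w \<in> P (Suc n - j)" and q: "q \<in> Q (Suc n)" and v: "v = (y ^^ j) w \<oplus>\<^bsub>M\<^esub> q"
        using vF by (auto simp: F_def set_add_mem)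
      have c: "(y ^^ j) w \<in> carrier M" "q \<in> carrier M" using yjc PD(3) w QD(3) q by auto
      have "(y ^^ j) w = v \<ominus>\<^bsub>M\<^esub> q" unfolding v a_minus_def using c by (simp add: M.a_assoc M.r_neg)
      moreover have "v \<ominus>\<^bsub>M\<^esub> q \<in> A (Suc j) (Suc n)"
        using vN q QF FA NA by (intro AD(7)) blast+
      ultimately have wD: "w \<in> D j (Suc n - j)" using w True by (simp add: D_def)
      have "(y ^^ j) w \<in> T <+>\<^bsub>M\<^esub> F (Suc j) (Suc n)"
      proof (cases "j \<le> j0")
        case j: True
        then have eq: "Suc n - j = Suc (n - j)" "n - j \<ge> n2" "n - j + j = n" using n by auto
        \<comment> \<open>For small order, \<open>w\<close> is generated by the first
          \<open>m\<close> variables from leading forms in degree \<open>n - j\<close>. Multiplied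
          by y^j these lift to \<open>N n\<close> up to higher order, and variables send
          \<open>N n\<close> into \<open>T\<close>.\<close>
        have "rspan R M (F 1 (Suc (n - j)) \<union> (\<Union>i<m. Y i ` D j (n - j)))
            \<subseteq> {w \<in> carrier M. (y ^^ j) w \<in> T <+>\<^bsub>M\<^esub> F (Suc j) (Suc n)}"
        proof (rule rspan_least[OF submodule_vimage[OF md md yj submodule_carrier[OF md] TFsub]], rule Un_least)
          show "F 1 (Suc (n - j)) \<subseteq> {w \<in> carrier M. (y ^^ j) w \<in> T <+>\<^bsub>M\<^esub> F (Suc j) (Suc n)}"
          proof
            fix w assume w: "w \<in> F 1 (Suc (n - j))"
            then have "(y ^^ j) w \<in> F (Suc j) (Suc n)" using yjF[OF w, of j] eq(3) by simp
            then show "w \<in> {w \<in> carrier M. (y ^^ j) w \<in> T <+>\<^bsub>M\<^esub> F (Suc j) (Suc n)}" using FTF FD(3)[OF w] by blast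
          qed
          show "(\<Union>i<m. Y i ` D j (n - j)) \<subseteq> {w \<in> carrier M. (y ^^ j) w \<in> T <+>\<^bsub>M\<^esub> F (Suc j) (Suc n)}"
          proof clarify
            fix i w assume i: "i < m" and w: "w \<in> D j (n - j)"
            then have wc: "w \<in> carrier M" using DP PD(3) by blast
            have "(y ^^ j) w \<in> A (Suc j) n" using w eq(3) by (simp add: D_def)
            then have "Y i ((y ^^ j) w) \<in> T <+>\<^bsub>M\<^esub> F (Suc j) (Suc n)" using i by (intro YA_TF) auto
            then show "Y i w \<in> carrier M \<and> (y ^^ j) (Y i w) \<in> T <+>\<^bsub>M\<^esub> F (Suc j) (Suc n)"
              using comm[of i w j] i wc rhomD(1)[OF sm(2)] by simp
          qed
        qed
        then show ?thesis using n2[OF j eq(2)] wD eq(1) by auto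
      next
        case j: False
        \<comment> \<open>For large order, stability shows that \<open>w\<close> is already a
          leading form of order \<open>j - 1\<close>, and the missing factor \<open>y\<close> acts
          on \<open>N n\<close>.\<close>
        then obtain j' where j': "j = Suc j'" "j' \<ge> j0" by (cases j) auto
        have "D j0 (Suc n - j) \<subseteq> D j' (Suc n - j)" using monoD[OF Dmono j'(2)] .
        then have "w \<in> D j' (Suc n - j)" using wD Ustable[of "Suc n - j"] unfolding U_def by blast
        then have "(y ^^ j') w \<in> A j n" using j' True by (simp add: D_def)
        then have "y ((y ^^ j') w) \<in> T <+>\<^bsub>M\<^esub> F (Suc j) (Suc n)" by (rule yA_TF)
        then show ?thesis using j' by simp
      qed
      moreover have "q \<in> T <+>\<^bsub>M\<^esub> F (Suc j) (Suc n)" using q GT TTF by blast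
      ultimately show ?thesis unfolding v using submoduleD(4)[OF md TFsub] by blast
    qed
    have "N (Suc n) \<subseteq> T <+>\<^bsub>M\<^esub> F j (Suc n)" for j
    proof (induction j)
      case 0
      then show ?case using FTF[of 0] F0 prems(7) by blast
    next
      case (Suc j)
      show ?case
      proof
        fix v assume v: "v \<in> N (Suc n)"
        then have "v \<in> T <+>\<^bsub>M\<^esub> F j (Suc n)" using Suc by blast
        then obtain t f where tf: "t \<in> T" "f \<in> F j (Suc n)" "v = t \<oplus>\<^bsub>M\<^esub> f" unfolding set_add_mem by blast
        have "f = v \<ominus>\<^bsub>M\<^esub> t" unfolding tf(3) a_minus_def using tf(1,2) TD(3) FD(3) by (simp add: M.a_ac M.r_neg M.r_neg1 M.r_neg2)
        then have "f \<in> N (Suc n)" using ND(7)[OF v] tf(1) TN by blast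
        then have "f \<in> T <+>\<^bsub>M\<^esub> F (Suc j) (Suc n)" using step tf(2) by blast
        then show "v \<in> T <+>\<^bsub>M\<^esub> F (Suc j) (Suc n)" unfolding tf(3) using TTF tf(1) submoduleD(4)[OF md TFsub] by blast
      qed
    qed
    \<comment> \<open>At \<open>j = n + 2\<close> the filtration in degree \<open>n + 1\<close> has
      come down to \<open>Q\<close>, which lies in \<open>T\<close>.\<close>
    from this[of "Suc (Suc n)"] have "N (Suc n) \<subseteq> T <+>\<^bsub>M\<^esub> Q (Suc n)" by (simp add: F_def)
    also have "\<dots> \<subseteq> T" using GT by (intro set_add_least[OF md Tsub]) auto
    finally show ?thesis unfolding T_def .
  qed
  then show ?case unfolding graded_fg_def eventually_sequentially by blast
qed

text \<open>Finiteness of both summands is essential, because \<open>enn2real\<close> sends infinity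
  to 0.\<close>

lemma enn2real_add_finite: "a < \<infinity> \<Longrightarrow> b < \<infinity> \<Longrightarrow> enn2real (a + b) = enn2real a + enn2real b"
  by (cases a; cases b) (auto simp flip: ennreal_plus)

text \<open>The last variable annihilates both its kernel \<open>K / Q\<close> and its cokernel, so
  the other \<open>m\<close> variables generate them. For the cokernel this is inherited from
  \<open>P\<close>; for the kernel it relies on the basis theorem. With no variables,
  \<open>P\<close> and \<open>Q\<close> agree in large degrees.\<close>

lemma hilbert_polynomial:
  fixes R :: "'r ring" and M :: "('r,'u) module" and lam :: "('r,'u) module \<Rightarrow> ennreal"
  assumes lam: "length_function R lam" and noeth: "noetherian_ring R" and fin: "loc_finite R lam M"
    and "smodule R m M Y" "graded_sub R m M Y P" "graded_sub R m M Y Q"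
    "\<And>n. fg_rsub R M (P n)" "\<And>n. Q n \<subseteq> P n" "graded_fg R m M Y P Q"
  shows "\<exists>q. (\<forall>i\<ge>m. coeff q i = 0) \<and>
    (\<forall>\<^sub>F n in sequentially. enn2real (lam (rsub M (P n))) - enn2real (lam (rsub M (Q n))) = poly q (real n))"
  using assms(4-)
proof (induction m arbitrary: P Q)
  case 0
  have "\<forall>\<^sub>F n in sequentially. P (Suc n) \<subseteq> rspan R M (Q (Suc n))"
    using "0.prems"(6) unfolding graded_fg_def by simp
  then have "\<forall>\<^sub>F n in sequentially. P (Suc n) = Q (Suc n)"
    by eventually_elim
      (use "0.prems"(5) rspan_of_submodule[OF graded_subD(1)[OF "0.prems"(3)]] in blast)
  then have "\<forall>\<^sub>F n in sequentially. P n = Q n" by (rule eventually_sequentially_Suc[THEN iffD1])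
  then have "\<forall>\<^sub>F n in sequentially. enn2real (lam (rsub M (P n))) - enn2real (lam (rsub M (Q n))) = poly 0 (real n)"
    by eventually_elim simp
  then show ?case by (intro exI[of _ 0]) simp
next
  case (Suc m)
  note prems = Suc.prems
  note sm = smoduleD[OF prems(1)]
  note md = sm(1)
  define L where "L V = enn2real (lam (rsub M V))" for V
  define y where "y = Y m"
  have y: "y \<in> rhom R M M" unfolding y_def by (intro sm) simp
  note P = graded_subD[OF prems(2)] and Q = graded_subD[OF prems(3)]
  have yQ: "y v \<in> Q (Suc n)" if "v \<in> Q n" for v n using Q(2)[of m] that unfolding y_def by simp
  have yP: "y v \<in> P (Suc n)" if "v \<in> P n" for v n using P(2)[of m] that unfolding y_def by simp
  \<comment> \<open>All submodules involved lie in some \<open>P n\<close>, so their lengths are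
    finite and may be subtracted as real numbers.\<close>
  have finP: "lam (rsub M V) < \<infinity>" if "submodule V R M" "V \<subseteq> P n" for V n
    using le_less_trans[OF length_mono[OF lam md that(1) P(1) that(2)] length_fg_finite[OF lam md fin prems(4)]] .
  have sm': "smodule R m M Y" by (rule smodule_mono[OF prems(1)]) simp
  have Qgr: "graded_sub R m M Y Q" by (rule graded_sub_mono[OF prems(3)]) simp
  define K where "K n = {v \<in> P n. y v \<in> Q (Suc n)}" for n
  have Ksub: "submodule (K n) R M" for n unfolding K_def by (rule submodule_vimage[OF md md y P(1) Q(1)])
  have KP: "K n \<subseteq> P n" for n unfolding K_def by blast
  have QK: "Q n \<subseteq> K n" for n unfolding K_def using prems(5)[of n] yQ by blast
  have Kgr: "graded_sub R (Suc m) M Y K"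
  proof (rule graded_subI[OF Ksub])
    fix n i v assume i: "i < Suc m" and v: "v \<in> K n"
    then have "v \<in> carrier M" using submoduleD(3)[OF md Ksub] by blast
    then have "y (Y i v) = Y i (y v)" unfolding y_def using i sm(3)[of m i v] by simp
    then show "Y i v \<in> K (Suc n)" using v P(2)[OF i] Q(2)[OF i] by (simp add: K_def)
  qed
  have Kfg: "fg_rsub R M (K n)" for n by (rule fg_rsub_of_noetherian[OF md noeth prems(4) Ksub KP])
  have "graded_fg R (Suc m) M Y K Q"
    by (rule graded_hilbert_basis[OF noeth prems(1-3) Kgr prems(4) QK KP prems(6)])
  then have KQ: "graded_fg R m M Y K Q"
    unfolding graded_fg_def
  proof eventually_elim
    case (elim n)
    have "Y m ` K n \<subseteq> Q (Suc n)" unfolding K_def y_def by blast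
    then have "Q (Suc n) \<union> (\<Union>i<Suc m. Y i ` K n) \<subseteq> Q (Suc n) \<union> (\<Union>i<m. Y i ` K n)"
      unfolding lessThan_Suc by blast
    then show ?case by (intro order_trans[OF elim rspan_mono])
  qed
  obtain p1 where p1: "\<forall>i\<ge>m. coeff p1 i = 0" "\<forall>\<^sub>F n in sequentially. L (K n) - L (Q n) = poly p1 (real n)"
    using Suc.IH[OF sm' graded_sub_mono[OF Kgr] Qgr Kfg QK KQ] unfolding L_def by auto
  \<comment> \<open>\<open>Q' n\<close> lives in degree \<open>n + 1\<close>: the cokernel is
    indexed by the degree of the source of \<open>y\<close> and hence paired with
    \<open>P (Suc n)\<close>.\<close>
  define Q' where "Q' n = y ` P n <+>\<^bsub>M\<^esub> Q (Suc n)" for n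
  have yPsub: "submodule (y ` P n) R M" for n by (rule submodule_image[OF md md y P(1)])
  have Q'sub: "submodule (Q' n) R M" for n unfolding Q'_def by (rule submodule_set_add[OF md yPsub Q(1)])
  have yPP: "y ` P n \<subseteq> P (Suc n)" for n using yP by blast
  have Q'P: "Q' n \<subseteq> P (Suc n)" for n unfolding Q'_def by (rule set_add_least[OF md P(1) yPP prems(5)])
  have Q'gr: "graded_sub R m M Y Q'"
  proof (rule graded_subI[OF Q'sub])
    fix n i v assume i: "i < m" and v: "v \<in> Q' n"
    have i': "i < Suc m" using i by simp
    show "Y i v \<in> Q' (Suc n)" unfolding Q'_def
    proof (rule image_set_add_subset[OF sm(2)[OF i'] _ _ _ _ v[unfolded Q'_def]])
      show "y ` P n \<subseteq> carrier M" "Q (Suc n) \<subseteq> carrier M"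
        using submoduleD(1)[OF md yPsub] submoduleD(1)[OF md Q(1)] by auto
      show "Y i ` y ` P n \<subseteq> y ` P (Suc n)"
        using sm(3)[of i m] i P(2)[OF i'] submoduleD(3)[OF md P(1)] by (auto simp: y_def)
      show "Y i ` Q (Suc n) \<subseteq> Q (Suc (Suc n))" using Q(2)[OF i'] by blast
    qed
  qed
  have P'gr: "graded_sub R m M Y (\<lambda>n. P (Suc n))"
    by (rule graded_subI[OF P(1)]) (rule P(2), auto)
  have P'Q': "graded_fg R m M Y (\<lambda>n. P (Suc n)) Q'"
  proof -
    have "\<forall>\<^sub>F n in sequentially. P (Suc (Suc n)) \<subseteq> rspan R M (Q (Suc (Suc n)) \<union> (\<Union>i<Suc m. Y i ` P (Suc n)))"
      using prems(6) unfolding graded_fg_def by (rule eventually_sequentially_Suc[THEN iffD2])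
    then show ?thesis unfolding graded_fg_def
    proof eventually_elim
      case (elim n)
      have "Y m ` P (Suc n) \<subseteq> Q' (Suc n)" "Q (Suc (Suc n)) \<subseteq> Q' (Suc n)"
        unfolding Q'_def using subset_set_add1[OF md yPsub Q(1)] subset_set_add2[OF md yPsub Q(1)]
        by (auto simp: y_def)
      then have "Q (Suc (Suc n)) \<union> (\<Union>i<Suc m. Y i ` P (Suc n)) \<subseteq> Q' (Suc n) \<union> (\<Union>i<m. Y i ` P (Suc n))"
        unfolding lessThan_Suc by blast
      then show ?case by (intro order_trans[OF elim rspan_mono])
    qed
  qed
  obtain p2 where p2: "\<forall>i\<ge>m. coeff p2 i = 0" "\<forall>\<^sub>F n in sequentially. L (P (Suc n)) - L (Q' n) = poly p2 (real n)"
    using Suc.IH[OF sm' P'gr Q'gr prems(4) Q'P P'Q'] unfolding L_def by auto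
  \<comment> \<open>This is the alternating sum of lengths for the exact sequence of K n / Q n, P n
    / Q n, P (n+1) / Q (n+1) and P (n+1) / Q' n. No quotient is formed: kernel and image of
    \<open>y\<close> on \<open>P n\<close> and on \<open>K n\<close>, together with the modular law,
    give the same count.\<close>
  have step: "(L (P (Suc n)) - L (Q (Suc n))) - (L (P n) - L (Q n)) = (L (P (Suc n)) - L (Q' n)) - (L (K n) - L (Q n))" for n
  proof -
    define Z where "Z = {v \<in> P n. y v = \<zero>\<^bsub>M\<^esub>}"
    have Zsub: "submodule Z R M" unfolding Z_def using submodule_vimage[OF md md y P(1) submodule_zero[OF md]] by simp
    have ZK: "{v \<in> K n. y v = \<zero>\<^bsub>M\<^esub>} = Z" unfolding K_def Z_def using submoduleD(2)[OF md Q(1)] by auto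
    have yK: "y ` K n = y ` P n \<inter> Q (Suc n)" unfolding K_def by blast
    have Isub: "submodule (y ` P n \<inter> Q (Suc n)) R M" by (rule submodule_Int[OF md yPsub Q(1)])
    have eqs: "lam (rsub M (P n)) = lam (rsub M Z) + lam (rsub M (y ` P n))"
      "lam (rsub M (K n)) = lam (rsub M Z) + lam (rsub M (y ` P n \<inter> Q (Suc n)))"
      "lam (rsub M (Q' n)) + lam (rsub M (y ` P n \<inter> Q (Suc n))) = lam (rsub M (y ` P n)) + lam (rsub M (Q (Suc n)))"
      using length_hom[OF lam md md y P(1)[of n]] length_hom[OF lam md md y Ksub[of n]]
        length_modular[OF lam md yPsub[of n] Q(1)[of "Suc n"]]
      unfolding ZK yK Q'_def by (simp_all only: Z_def)
    have fins: "lam (rsub M Z) < \<infinity>" "lam (rsub M (y ` P n)) < \<infinity>" "lam (rsub M (y ` P n \<inter> Q (Suc n))) < \<infinity>"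
      "lam (rsub M (Q (Suc n))) < \<infinity>" "lam (rsub M (Q' n)) < \<infinity>"
      using finP[OF Zsub, of n] finP[OF yPsub yPP] finP[OF Isub le_infI1[OF yPP]] finP[OF Q(1) prems(5)]
        finP[OF Q'sub Q'P] by (auto simp: Z_def)
    have "L (P n) = L Z + L (y ` P n)" "L (K n) = L Z + L (y ` P n \<inter> Q (Suc n))"
      using fins unfolding L_def eqs by (simp_all add: enn2real_add_finite)
    moreover have "L (Q' n) + L (y ` P n \<inter> Q (Suc n)) = L (y ` P n) + L (Q (Suc n))"
      using fins arg_cong[OF eqs(3), of enn2real] unfolding L_def by (simp add: enn2real_add_finite)
    ultimately show ?thesis by simp
  qed
  show ?case unfolding L_def[symmetric]
  proof (rule eventually_poly_of_difference[of m "p2 - p1"])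
    show "coeff (p2 - p1) i = 0" if "i \<ge> m" for i using p1(1) p2(1) that by simp
    show "\<forall>\<^sub>F n in sequentially. L (P (Suc n)) - L (Q (Suc n)) - (L (P n) - L (Q n)) = poly (p2 - p1) (real n)"
      using p1(2) p2(2) by eventually_elim (simp add: step)
  qed
qed

section \<open>Modules over the polynomial ring\<close>

lemma shomD:
  assumes "f \<in> shom R k M X N Y"
  shows "f \<in> rhom R M N" "\<And>i v. i < k \<Longrightarrow> v \<in> carrier M \<Longrightarrow> f (X i v) = Y i (f v)"
  using assms unfolding shom_def by auto

lemma ssubD:
  assumes "ssub R k M X N"
  shows "submodule N R M" "\<And>i v. i < k \<Longrightarrow> v \<in> N \<Longrightarrow> X i v \<in> N"
  using assms unfolding ssub_def by auto

lemma smodule_rsub: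
  assumes "smodule R k M X" "ssub R k M X N"
  shows "smodule R k (rsub M N) X"
proof -
  note sm = smoduleD[OF assms(1)] and N = ssubD[OF assms(2)]
  note ND = submoduleD(3)[OF sm(1) N(1)]
  have "X i \<in> rhom R (rsub M N) (rsub M N)" if "i < k" for i
    using rhomD[OF sm(2)[OF that]] N(2)[OF that] ND unfolding rhom_def by auto
  then show ?thesis unfolding smodule_def using module_rsub[OF sm(1) N(1)] sm(3) ND by auto
qed

lemma ssub_carrier: "smodule R k M X \<Longrightarrow> ssub R k M X (carrier M)"
  using submodule_carrier[OF smoduleD(1)] rhomD(1)[OF smoduleD(2)] unfolding ssub_def by auto

lemma ssub_zero:
  assumes "smodule R k M X"
  shows "ssub R k M X {\<zero>\<^bsub>M\<^esub>}"
  using submodule_zero[OF smoduleD(1)[OF assms]]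
    rhom_zero[OF smoduleD(1)[OF assms] smoduleD(1)[OF assms] smoduleD(2)[OF assms]] unfolding ssub_def by simp

lemma sspan_superset: "G \<subseteq> sspan R k M X G"
  unfolding sspan_def by auto

lemma sspan_least: "ssub R k M X N \<Longrightarrow> G \<subseteq> N \<Longrightarrow> sspan R k M X G \<subseteq> N"
  unfolding sspan_def by auto

lemma sspan_mono: "G \<subseteq> G' \<Longrightarrow> sspan R k M X G \<subseteq> sspan R k M X G'"
  unfolding sspan_def by auto

section \<open>The filtration of a module by polynomial degree\<close>

lemma Sn_span_mono: "m \<le> n \<Longrightarrow> V \<subseteq> W \<Longrightarrow> Sn_span R k M X m V \<subseteq> Sn_span R k M X n W"
  unfolding Sn_span_def by (intro rspan_mono) force

lemma subset_Sn_span: "V \<subseteq> Sn_span R k M X n V"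
proof
  fix v assume "v \<in> V"
  then have "v \<in> {monact X xs v | xs v. set xs \<subseteq> {..<k} \<and> length xs \<le> n \<and> v \<in> V}"
    by (intro CollectI exI[of _ "[]"] exI[of _ v]) (auto simp: monact_def)
  then show "v \<in> Sn_span R k M X n V" unfolding Sn_span_def by (rule subsetD[OF rspan_superset])
qed

text \<open>Induction on words: each variable moves up one level of \<open>W\<close>. Constant and
  shifted sequences \<open>W\<close> are the cases used later.\<close>

lemma Sn_span_least:
  assumes "\<And>n. submodule (W n) R M" "V \<subseteq> W 0" "\<And>n. W n \<subseteq> W (Suc n)"
    "\<And>n i v. i < k \<Longrightarrow> v \<in> W n \<Longrightarrow> X i v \<in> W (Suc n)"
  shows "Sn_span R k M X n V \<subseteq> W n"
  unfolding Sn_span_def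
proof (rule rspan_least[OF assms(1)], clarify)
  fix xs v assume xs: "set xs \<subseteq> {..<k}" "length xs \<le> n" and v: "v \<in> V"
  have "monact X xs v \<in> W (length xs)"
    using xs(1) by (induction xs) (use v assms(2,4) in \<open>auto simp: monact_def\<close>)
  then show "monact X xs v \<in> W n" using lift_Suc_mono_le[of W, OF assms(3) xs(2)] by blast
qed

context
  fixes R :: "'r ring" and k :: nat and M :: "('r,'u) module" and X :: "nat \<Rightarrow> 'u \<Rightarrow> 'u"
  assumes sm: "smodule R k M X"
begin

lemma monact_closed:
  assumes "set xs \<subseteq> {..<k}" "v \<in> carrier M"
  shows "monact X xs v \<in> carrier M"
  using assms by (induction xs) (auto simp: monact_def intro: rhomD(1)[OF smoduleD(2)[OF sm]])

lemma Sn_generators_closed: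
  "V \<subseteq> carrier M \<Longrightarrow> {monact X xs v | xs v. set xs \<subseteq> {..<k} \<and> length xs \<le> n \<and> v \<in> V} \<subseteq> carrier M"
  using monact_closed by blast

lemma submodule_Sn_span: "V \<subseteq> carrier M \<Longrightarrow> submodule (Sn_span R k M X n V) R M"
  unfolding Sn_span_def by (rule submodule_rspan[OF smoduleD(1)[OF sm] Sn_generators_closed])

lemma Sn_span_step:
  assumes "V \<subseteq> carrier M" "i < k" "v \<in> Sn_span R k M X n V"
  shows "X i v \<in> Sn_span R k M X (Suc n) V"
proof -
  let ?G = "\<lambda>n. {monact X xs v | xs v. set xs \<subseteq> {..<k} \<and> length xs \<le> n \<and> v \<in> V}"
  have "X i ` rspan R M (?G n) = rspan R M (X i ` ?G n)"
    using image_rspan[OF smoduleD(1)[OF sm] smoduleD(1)[OF sm] smoduleD(2)[OF sm] Sn_generators_closed] assms by blast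
  also have "\<dots> \<subseteq> rspan R M (?G (Suc n))"
  proof (intro rspan_mono subsetI)
    fix z assume "z \<in> X i ` ?G n"
    then obtain xs v where "set xs \<subseteq> {..<k}" "length xs \<le> n" "v \<in> V" "z = X i (monact X xs v)" by blast
    then show "z \<in> ?G (Suc n)" using assms(2)
      by (intro CollectI exI[of _ "i # xs"] exI[of _ v]) (auto simp: monact_def)
  qed
  finally show ?thesis using assms(3) unfolding Sn_span_def by blast
qed

text \<open>Peel the outermost letter off a word of length \<open>n + 1\<close>; shorter words are
  covered by the inclusion of the previous level.\<close>

lemma Sn_span_Suc:
  assumes "V \<subseteq> carrier M"
  shows "Sn_span R k M X (Suc n) V \<subseteq> rspan R M (Sn_span R k M X n V \<union> (\<Union>i<k. X i ` Sn_span R k M X n V))"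
proof -
  let ?G = "\<lambda>n. {monact X xs v | xs v. set xs \<subseteq> {..<k} \<and> length xs \<le> n \<and> v \<in> V}"
  have G: "?G n \<subseteq> Sn_span R k M X n V" unfolding Sn_span_def by (rule rspan_superset)
  have "?G (Suc n) \<subseteq> rspan R M (Sn_span R k M X n V \<union> (\<Union>i<k. X i ` Sn_span R k M X n V))"
  proof
    fix z assume "z \<in> ?G (Suc n)"
    then obtain xs v where z: "set xs \<subseteq> {..<k}" "length xs \<le> Suc n" "v \<in> V" "z = monact X xs v" by blast
    have "z \<in> Sn_span R k M X n V \<union> (\<Union>i<k. X i ` Sn_span R k M X n V)"
    proof (cases xs)
      case Nil
      then show ?thesis using z subset_Sn_span[of V R k M X n] by (auto simp: monact_def)
    next
      case (Cons i ys)
      then have "monact X ys v \<in> ?G n" using z by auto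
      then have "monact X ys v \<in> Sn_span R k M X n V" using G by blast
      moreover have "z = X i (monact X ys v)" "i < k" using z Cons by (auto simp: monact_def)
      ultimately show ?thesis by blast
    qed
    then show "z \<in> rspan R M (Sn_span R k M X n V \<union> (\<Union>i<k. X i ` Sn_span R k M X n V))"
      by (rule subsetD[OF rspan_superset])
  qed
  moreover have "Sn_span R k M X n V \<union> (\<Union>i<k. X i ` Sn_span R k M X n V) \<subseteq> carrier M"
    using submoduleD(1)[OF smoduleD(1)[OF sm] submodule_Sn_span[OF assms]] Sn_span_step[OF assms] by blast
  ultimately show ?thesis unfolding Sn_span_def[of _ _ _ _ "Suc n"]
    by (intro rspan_least submodule_rspan smoduleD(1)[OF sm])
qed

lemma Sn_span_shift:
  assumes "V \<subseteq> carrier M" "W \<subseteq> Sn_span R k M X c V"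
  shows "Sn_span R k M X n W \<subseteq> Sn_span R k M X (n + c) V"
proof (rule Sn_span_least[of "\<lambda>n. Sn_span R k M X (n + c) V"])
  show "Sn_span R k M X (n + c) V \<subseteq> Sn_span R k M X (Suc n + c) V" for n by (rule Sn_span_mono) auto
qed (use assms in \<open>auto intro: submodule_Sn_span Sn_span_step\<close>)

text \<open>The union is already closed under the variables. Hence membership in an
  \<open>S\<close>-span is always witnessed in a finite degree.\<close>

lemma sspan_eq_UN:
  assumes "V \<subseteq> carrier M"
  shows "sspan R k M X V = (\<Union>n. Sn_span R k M X n V)"
proof
  have mono: "mono (\<lambda>n. Sn_span R k M X n V)" by (intro monoI Sn_span_mono order_refl)
  have "ssub R k M X (\<Union>n. Sn_span R k M X n V)" unfolding ssub_def
    using submodule_UN_chain[OF smoduleD(1)[OF sm] submodule_Sn_span[OF assms] mono] Sn_span_step[OF assms] by blast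
  then show "sspan R k M X V \<subseteq> (\<Union>n. Sn_span R k M X n V)"
    by (rule sspan_least) (use subset_Sn_span[of V R k M X 0] in blast)
  show "(\<Union>n. Sn_span R k M X n V) \<subseteq> sspan R k M X V"
  proof (rule UN_least)
    fix n
    show "Sn_span R k M X n V \<subseteq> sspan R k M X V" unfolding sspan_def
    proof (rule Inter_greatest)
      fix N assume "N \<in> {N. ssub R k M X N \<and> V \<subseteq> N}"
      then show "Sn_span R k M X n V \<subseteq> N" by (intro Sn_span_least[of "\<lambda>_. N"]) (auto dest: ssubD)
    qed
  qed
qed

lemma ssub_sspan:
  assumes "V \<subseteq> carrier M"
  shows "ssub R k M X (sspan R k M X V)"
proof -
  have mono: "mono (\<lambda>n. Sn_span R k M X n V)" by (intro monoI Sn_span_mono order_refl)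
  show ?thesis unfolding sspan_eq_UN[OF assms] ssub_def
    using submodule_UN_chain[OF smoduleD(1)[OF sm] submodule_Sn_span[OF assms] mono] Sn_span_step[OF assms] by blast
qed

text \<open>\<open>V\<close> can be replaced by a finite generating set, and there are finitely many
  words of length at most \<open>n\<close> in \<open>k\<close> letters.\<close>

lemma fg_Sn_span:
  assumes "fg_rsub R M V"
  shows "fg_rsub R M (Sn_span R k M X n V)"
proof -
  obtain G where G: "finite G" "G \<subseteq> carrier M" "V = rspan R M G" using assms unfolding fg_rsub_def by blast
  let ?L = "{xs. set xs \<subseteq> {..<k} \<and> length xs \<le> n}"
  have "V \<subseteq> Sn_span R k M X 0 G" unfolding G(3) by (rule rspan_least[OF submodule_Sn_span[OF G(2)] subset_Sn_span])
  then have "Sn_span R k M X n V \<subseteq> Sn_span R k M X n G" using Sn_span_shift[OF G(2), of V 0 n] by simp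
  moreover have "Sn_span R k M X n G \<subseteq> Sn_span R k M X n V"
    unfolding G(3) by (intro Sn_span_mono rspan_superset order_refl)
  ultimately have eq: "Sn_span R k M X n V = rspan R M {monact X xs v | xs v. set xs \<subseteq> {..<k} \<and> length xs \<le> n \<and> v \<in> G}"
    unfolding Sn_span_def by blast
  have "{monact X xs v | xs v. set xs \<subseteq> {..<k} \<and> length xs \<le> n \<and> v \<in> G}
      = (\<lambda>(xs, v). monact X xs v) ` (?L \<times> G)" by auto
  moreover have "finite (?L \<times> G)" using G(1) by (intro finite_cartesian_product finite_lists_length_le) auto
  ultimately have "finite {monact X xs v | xs v. set xs \<subseteq> {..<k} \<and> length xs \<le> n \<and> v \<in> G}" by simp
  then show ?thesis unfolding fg_rsub_def using Sn_generators_closed[OF G(2), of n] eq by blast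
qed

text \<open>The finitely many generators of \<open>W\<close> occur in finitely many degrees, whose
  maximum is the offset \<open>c\<close>.\<close>

lemma fg_subset_Sn_span:
  assumes "V \<subseteq> carrier M" "fg_rsub R M W" "W \<subseteq> sspan R k M X V"
  obtains c where "W \<subseteq> Sn_span R k M X c V"
proof -
  obtain G where G: "finite G" "G \<subseteq> carrier M" "W = rspan R M G" using assms(2) unfolding fg_rsub_def by blast
  have "G \<subseteq> (\<Union>n. Sn_span R k M X n V)"
    using assms(3) rspan_superset[of G R M] unfolding G(3) sspan_eq_UN[OF assms(1)] by blast
  with G(1) have "\<exists>c. G \<subseteq> Sn_span R k M X c V"
  proof (induction G)
    case (insert x F)
    then obtain i j where "x \<in> Sn_span R k M X i V" "F \<subseteq> Sn_span R k M X j V" by auto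
    then have "insert x F \<subseteq> Sn_span R k M X (max i j) V"
      using Sn_span_mono[of i "max i j" V V R k M X] Sn_span_mono[of j "max i j" V V R k M X] by auto
    then show ?case by blast
  qed auto
  then obtain c where "G \<subseteq> Sn_span R k M X c V" by blast
  then have "W \<subseteq> Sn_span R k M X c V" unfolding G(3) by (rule rspan_least[OF submodule_Sn_span[OF assms(1)]])
  then show ?thesis by (rule that)
qed

lemma Sn_span_rsub:
  assumes "ssub R k M X N" "V \<subseteq> N"
  shows "Sn_span R k (rsub M N) X n V = Sn_span R k M X n V"
proof -
  have "monact X xs v \<in> N" if "set xs \<subseteq> {..<k}" "v \<in> V" for xs v
    using that by (induction xs) (use assms ssubD(2)[OF assms(1)] in \<open>auto simp: monact_def\<close>)
  then show ?thesis unfolding Sn_span_def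
    by (intro rspan_rsub[OF smoduleD(1)[OF sm] ssubD(1)[OF assms(1)]]) blast
qed

end

lemma sspan_rsub:
  assumes "smodule R k M X" "ssub R k M X N" "V \<subseteq> N"
  shows "sspan R k (rsub M N) X V = sspan R k M X V"
proof -
  have "V \<subseteq> carrier M" using assms submoduleD(1)[OF smoduleD(1)[OF assms(1)] ssubD(1)[OF assms(2)]] by blast
  then show ?thesis
    using sspan_eq_UN[OF assms(1)] sspan_eq_UN[OF smodule_rsub[OF assms(1,2)]] Sn_span_rsub[OF assms] assms(3) by auto
qed

lemma image_Sn_span:
  assumes "smodule R k M X" "smodule R k N Y" "f \<in> shom R k M X N Y" "V \<subseteq> carrier M"
  shows "f ` Sn_span R k M X n V = Sn_span R k N Y n (f ` V)"
proof -
  have *: "f (monact X xs v) = monact Y xs (f v)" if "set xs \<subseteq> {..<k}" "v \<in> carrier M" for xs v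
    using that(1)
  proof (induction xs)
    case (Cons i xs)
    then have "monact X xs v \<in> carrier M" using monact_closed[OF assms(1) _ that(2)] by auto
    then show ?case using Cons shomD(2)[OF assms(3)] by (auto simp: monact_def)
  qed (simp add: monact_def)
  have "f ` {monact X xs v | xs v. set xs \<subseteq> {..<k} \<and> length xs \<le> n \<and> v \<in> V}
    = {monact Y xs v | xs v. set xs \<subseteq> {..<k} \<and> length xs \<le> n \<and> v \<in> f ` V}" (is "f ` ?G = ?G'")
  proof
    show "f ` ?G \<subseteq> ?G'" using * assms(4) by blast
    show "?G' \<subseteq> f ` ?G"
    proof
      fix z assume "z \<in> ?G'"
      then obtain xs v where z: "set xs \<subseteq> {..<k}" "length xs \<le> n" "v \<in> V" "z = monact Y xs (f v)" by blast
      then have "z = f (monact X xs v)" using * assms(4) by auto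
      then show "z \<in> f ` ?G" using z by blast
    qed
  qed
  then show ?thesis unfolding Sn_span_def
    using image_rspan[OF smoduleD(1)[OF assms(1)] smoduleD(1)[OF assms(2)] shomD(1)[OF assms(3)] Sn_generators_closed[OF assms(1,4)], of n]
    by simp
qed

lemma image_sspan:
  assumes "smodule R k M X" "smodule R k N Y" "f \<in> shom R k M X N Y" "V \<subseteq> carrier M"
  shows "f ` sspan R k M X V = sspan R k N Y (f ` V)"
proof -
  have "f ` V \<subseteq> carrier N" using assms(4) rhomD(1)[OF shomD(1)[OF assms(3)]] by blast
  then show ?thesis
    by (simp add: sspan_eq_UN[OF assms(1,4)] sspan_eq_UN[OF assms(2)] image_UN image_Sn_span[OF assms])
qed

section \<open>The leading monomial of a small module\<close>

text \<open>This is the condition under the choice operator of \<open>mu_small\<close>, with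
  \<open>V\<close> and \<open>q\<close> made arguments so that the choice can be evaluated from any
  one witness.\<close>

definition hilbert_pair :: "'r ring \<Rightarrow> (('r,'u) module \<Rightarrow> ennreal) \<Rightarrow> nat \<Rightarrow> ('r,'u) module
    \<Rightarrow> (nat \<Rightarrow> 'u \<Rightarrow> 'u) \<Rightarrow> 'u set \<Rightarrow> real poly \<Rightarrow> bool" where
  "hilbert_pair R lam k M X V q \<longleftrightarrow> fg_rsub R M V \<and> lam (rsub M V) < \<infinity>
       \<and> sspan R k M X V = carrier M \<and> degree q \<le> k
       \<and> (\<forall>\<^sub>F n in sequentially. 0 \<le> poly q (real n)
            \<and> lam (rsub M (Sn_span R k M X n V)) = ennreal (poly q (real n)))"

lemma hilbert_pairD:
  assumes "hilbert_pair R lam k M X V q"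
  shows "fg_rsub R M V" "sspan R k M X V = carrier M" "degree q \<le> k"
    "\<forall>\<^sub>F n in sequentially. 0 \<le> poly q (real n)"
    "\<forall>\<^sub>F n in sequentially. lam (rsub M (Sn_span R k M X n V)) = ennreal (poly q (real n))"
  using assms unfolding hilbert_pair_def by (auto simp: eventually_conj_iff)

lemma fg_smodE:
  assumes "smodule R k M X" "fg_smod R k M X"
  obtains V where "fg_rsub R M V" "sspan R k M X V = carrier M"
proof -
  obtain G where G: "finite G" "G \<subseteq> carrier M" "sspan R k M X G = carrier M"
    using assms(2) unfolding fg_smod_def by blast
  have "rspan R M G \<subseteq> carrier M" by (rule rspan_subset_carrier[OF smoduleD(1)[OF assms(1)] G(2)])
  then have "sspan R k M X (rspan R M G) \<subseteq> carrier M" by (rule sspan_least[OF ssub_carrier[OF assms(1)]])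
  moreover have "carrier M \<subseteq> sspan R k M X (rspan R M G)"
    using sspan_mono[OF rspan_superset[of G R M], of R k M X] G(3) by simp
  ultimately have "sspan R k M X (rspan R M G) = carrier M" by blast
  moreover have "fg_rsub R M (rspan R M G)" unfolding fg_rsub_def using G by blast
  ultimately show ?thesis by (rule that[rotated])
qed

lemma fg_smodI:
  assumes "smodule R k M X" "fg_rsub R M V" "sspan R k M X V = carrier M"
  shows "fg_smod R k M X"
proof -
  obtain G where G: "finite G" "G \<subseteq> carrier M" "V = rspan R M G" using assms(2) unfolding fg_rsub_def by blast
  have s: "ssub R k M X (sspan R k M X G)" by (rule ssub_sspan[OF assms(1) G(2)])
  have "rspan R M G \<subseteq> sspan R k M X G" by (rule rspan_least[OF ssubD(1)[OF s] sspan_superset])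
  then have "carrier M \<subseteq> sspan R k M X G" using sspan_least[OF s, of V] G(3) assms(3) by simp
  moreover have "sspan R k M X G \<subseteq> carrier M" by (rule sspan_least[OF ssub_carrier[OF assms(1)] G(2)])
  ultimately show ?thesis unfolding fg_smod_def using G by blast
qed

text \<open>The identity commutes with all variables, and \<open>k\<close> is the first free
  index.\<close>

lemma smodule_add_identity:
  assumes "smodule R k M X"
  shows "smodule R (Suc k) M (X(k := id))"
proof -
  note sm = smoduleD[OF assms]
  have "id \<in> rhom R M M" unfolding rhom_def by auto
  then have "(X(k := id)) i \<in> rhom R M M" if "i < Suc k" for i
    using sm(2) that by (cases "i = k") auto
  moreover have "(X(k := id)) i ((X(k := id)) j v) = (X(k := id)) j ((X(k := id)) i v)"
    if "i < Suc k" "j < Suc k" "v \<in> carrier M" for i j v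
    using sm(3)[of i j v] that by (cases "i = k"; cases "j = k") auto
  ultimately show ?thesis unfolding smodule_def using sm(1) by blast
qed

lemma UN_add_identity: "(\<Union>i<Suc k. (X(k := id)) i ` V) = V \<union> (\<Union>i<k. X i ` V)"
proof -
  have "(\<Union>i<k. (X(k := id)) i ` V) = (\<Union>i<k. X i ` V)" by (rule SUP_cong) auto
  then show ?thesis unfolding lessThan_Suc by simp
qed

text \<open>The filtration \<open>S_n V\<close>, regarded as a graded module over \<open>R[x_1, ..., x_k, t]\<close> (the Rees
  module), where the additional variable \<open>t\<close> acts by the inclusion of \<open>S_n V\<close> in \<open>S_(n+1) V\<close>.\<close>
lemma rees_graded:
  assumes "smodule R k M X" "V \<subseteq> carrier M"
  shows "graded_sub R (Suc k) M (X(k := id)) (\<lambda>n. Sn_span R k M X n V)"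
    "graded_fg R (Suc k) M (X(k := id)) (\<lambda>n. Sn_span R k M X n V) (\<lambda>n. {\<zero>\<^bsub>M\<^esub>})"
proof -
  show "graded_sub R (Suc k) M (X(k := id)) (\<lambda>n. Sn_span R k M X n V)"
  proof (rule graded_subI[OF submodule_Sn_span[OF assms]])
    fix n i v assume i: "i < Suc k" and v: "v \<in> Sn_span R k M X n V"
    show "(X(k := id)) i v \<in> Sn_span R k M X (Suc n) V"
    proof (cases "i = k")
      case True
      then show ?thesis using v Sn_span_mono[of n "Suc n" V V R k M X] by auto
    next
      case False
      then show ?thesis using Sn_span_step[OF assms _ v, of i] i by simp
    qed
  qed
  have "Sn_span R k M X (Suc n) V \<subseteq> rspan R M ({\<zero>\<^bsub>M\<^esub>} \<union> (\<Union>i<Suc k. (X(k := id)) i ` Sn_span R k M X n V))" for n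
    unfolding UN_add_identity by (rule order_trans[OF Sn_span_Suc[OF assms] rspan_mono]) blast
  then show "graded_fg R (Suc k) M (X(k := id)) (\<lambda>n. Sn_span R k M X n V) (\<lambda>n. {\<zero>\<^bsub>M\<^esub>})"
    unfolding graded_fg_def by simp
qed

lemma graded_sub_zero:
  assumes "smodule R m M Y"
  shows "graded_sub R m M Y (\<lambda>n. {\<zero>\<^bsub>M\<^esub>})"
  using ssub_zero[OF assms] by (intro graded_subI) (auto dest: ssubD)

lemma loc_finite_rsub:
  assumes "module R M" "submodule N R M" "loc_finite R lam M"
  shows "loc_finite R lam (rsub M N)"
  using assms(3) rspan_rsub[OF assms(1,2)] submoduleD(3)[OF assms(1,2)] unfolding loc_finite_def by simp

section \<open>Local finiteness in exact sequences and independence of the generators\<close>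

context
  fixes R :: "'r ring" and lam :: "('r,'u) module \<Rightarrow> ennreal"
  assumes lam: "length_function R lam"
begin

lemma loc_finite_inj:
  assumes "module R A" "module R B" "f \<in> rhom R A B" "inj_on f (carrier A)" "loc_finite R lam B"
  shows "loc_finite R lam A"
  unfolding loc_finite_def
proof
  fix v assume v: "v \<in> carrier A"
  have "lam (rsub A (rspan R A {v})) = lam (rsub B (f ` rspan R A {v}))"
    using length_inj[OF lam assms(1-4) submodule_rspan[OF assms(1)]] v by simp
  also have "\<dots> = lam (rsub B (rspan R B {f v}))" using image_rspan[OF assms(1-3), of "{v}"] v by simp
  also have "\<dots> < \<infinity>" using assms(5) rhomD(1)[OF assms(3) v] unfolding loc_finite_def by blast
  finally show "lam (rsub A (rspan R A {v})) < \<infinity>" .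
qed

lemma loc_finite_surj:
  assumes "module R B" "module R C" "f \<in> rhom R B C" "f ` carrier B = carrier C" "loc_finite R lam B"
  shows "loc_finite R lam C"
  unfolding loc_finite_def
proof
  fix v assume "v \<in> carrier C"
  then obtain b where b: "b \<in> carrier B" "v = f b" using assms(4) by blast
  have "lam (rsub C (rspan R C {v})) = lam (rsub C (f ` rspan R B {b}))"
    using image_rspan[OF assms(1-3), of "{b}"] b by simp
  also have "\<dots> \<le> lam (rsub B (rspan R B {b}))"
    using length_hom[OF lam assms(1-3) submodule_rspan[OF assms(1)], of "{b}"] b by simp
  also have "\<dots> < \<infinity>" using assms(5) b(1) unfolding loc_finite_def by blast
  finally show "lam (rsub C (rspan R C {v})) < \<infinity>" .
qed

text \<open>The growth of \<open>V1\<close> at \<open>n\<close> is bounded by that of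
  \<open>V2\<close> at \<open>n + c\<close>, and the offset disappears in the leading monomial. The
  separate modules \<open>M1\<close> and \<open>M2\<close> cover two generating sets of one module
  as well as generating sets of nested submodules, whose Hilbert pairs belong to different
  records.\<close>

lemma lead_mono_le_of_Sn_span:
  assumes "smodule R k M X" "hilbert_pair R lam k M1 X1 V1 p" "hilbert_pair R lam k M2 X2 V2 q"
    "\<And>n. rsub M1 (Sn_span R k M1 X1 n V1) = rsub M (Sn_span R k M X n V1)"
    "\<And>n. rsub M2 (Sn_span R k M2 X2 n V2) = rsub M (Sn_span R k M X n V2)"
    "V1 \<subseteq> carrier M" "V2 \<subseteq> carrier M" "V1 \<subseteq> Sn_span R k M X c V2"
  shows "mono_le (lead_mono p) (lead_mono q)"
proof -
  have "mono_le (lead_mono p) (lead_mono (q \<circ>\<^sub>p [:real c, 1:]))"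
  proof (rule lead_mono_mono)
    show "\<forall>\<^sub>F n in sequentially. 0 \<le> poly p (real n)" by (rule hilbert_pairD(4)[OF assms(2)])
    have "\<forall>\<^sub>F n in sequentially. 0 \<le> poly q (real (n + c)) \<and> lam (rsub M2 (Sn_span R k M2 X2 (n + c) V2)) = ennreal (poly q (real (n + c)))"
      using eventually_conj[OF hilbert_pairD(4,5)[OF assms(3)]] by (rule sequentially_offset)
    with hilbert_pairD(4,5)[OF assms(2)]
    show "\<forall>\<^sub>F n in sequentially. poly p (real n) \<le> poly (q \<circ>\<^sub>p [:real c, 1:]) (real n)"
    proof eventually_elim
      case (elim n)
      have "lam (rsub M (Sn_span R k M X n V1)) \<le> lam (rsub M (Sn_span R k M X (n + c) V2))"
        by (intro length_mono[OF lam] smoduleD(1)[OF assms(1)] submodule_Sn_span[OF assms(1)] assms(6,7)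
            Sn_span_shift[OF assms(1) assms(7,8)])
      then have "ennreal (poly p (real n)) \<le> ennreal (poly q (real (n + c)))"
        using elim unfolding assms(4,5) by simp
      then show ?case using elim by (simp add: poly_pcompose add.commute)
    qed
  qed
  then show ?thesis by (simp add: lead_mono_shift)
qed

text \<open>An inequality suffices, since exchanging \<open>V\<close> and \<open>W\<close> gives the
  other one.\<close>

lemma lead_mono_unique:
  assumes "smodule R k M X" "hilbert_pair R lam k M X V p" "hilbert_pair R lam k M X W q"
  shows "mono_le (lead_mono p) (lead_mono q)"
proof -
  note md = smoduleD(1)[OF assms(1)]
  note V = hilbert_pairD[OF assms(2)] and W = hilbert_pairD[OF assms(3)]
  have c: "V \<subseteq> carrier M" "W \<subseteq> carrier M"
    using submoduleD(1)[OF md submodule_of_fg[OF md V(1)]] submoduleD(1)[OF md submodule_of_fg[OF md W(1)]] .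
  obtain c where "V \<subseteq> Sn_span R k M X c W"
    using fg_subset_Sn_span[OF assms(1) c(2) V(1)] W(2) c(1) by blast
  then show ?thesis by (intro lead_mono_le_of_Sn_span[OF assms refl refl c])
qed

lemma mu_small_eq:
  assumes "smodule R k M X" "hilbert_pair R lam k M X V q"
  shows "mu_small R lam k M X = lead_mono q"
proof -
  have "mu_small R lam k M X = (SOME m. \<exists>V q. hilbert_pair R lam k M X V q \<and> m = lead_mono q)"
    unfolding mu_small_def hilbert_pair_def by (simp add: conj_assoc)
  also have "\<dots> = lead_mono q"
  proof (rule some_equality)
    show "\<exists>V p. hilbert_pair R lam k M X V p \<and> lead_mono q = lead_mono p" using assms(2) by blast
    fix m assume "\<exists>V p. hilbert_pair R lam k M X V p \<and> m = lead_mono p"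
    then show "m = lead_mono q" using lead_mono_unique[OF assms(1)] assms(2) mono_le_antisym by blast
  qed
  finally show ?thesis .
qed

end

section \<open>Existence, additivity and monotonicity over a Noetherian ring\<close>

context
  fixes R :: "'r ring" and lam :: "('r,'u) module \<Rightarrow> ennreal" and k :: nat
  assumes lam: "length_function R lam" and noeth: "noetherian_ring R"
begin

text \<open>The filtration modulo zero is a graded module over \<open>k + 1\<close> variables, so
  the coefficients of its polynomial have index at most \<open>k\<close>: hence the degree
  bound.\<close>

lemma exists_hilbert_pair:
  assumes "smodule R k M X" "loc_finite R lam M" "fg_rsub R M V" "sspan R k M X V = carrier M"
  obtains q where "hilbert_pair R lam k M X V q"
proof -
  note md = smoduleD(1)[OF assms(1)]
  have Vc: "V \<subseteq> carrier M" by (rule submoduleD(1)[OF md submodule_of_fg[OF md assms(3)]])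
  note sub = submodule_Sn_span[OF assms(1) Vc]
  have fin: "lam (rsub M (Sn_span R k M X n V)) < \<infinity>" for n
    by (rule length_fg_finite[OF lam md assms(2) fg_Sn_span[OF assms(1,3)]])
  have sm: "smodule R (Suc k) M (X(k := id))" by (rule smodule_add_identity[OF assms(1)])
  have z: "{\<zero>\<^bsub>M\<^esub>} \<subseteq> Sn_span R k M X n V" for n using submoduleD(2)[OF md sub] by blast
  have lam0: "lam (rsub M {\<zero>\<^bsub>M\<^esub>}) = 0"
    by (rule length_functionD(1)[OF lam module_rsub[OF md submodule_zero[OF md]]]) simp
  obtain q where q: "\<forall>i\<ge>Suc k. coeff q i = 0"
    "\<forall>\<^sub>F n in sequentially. enn2real (lam (rsub M (Sn_span R k M X n V))) = poly q (real n)"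
    using hilbert_polynomial[OF lam noeth assms(2) sm rees_graded(1)[OF assms(1) Vc] graded_sub_zero[OF sm]
        fg_Sn_span[OF assms(1,3)] z rees_graded(2)[OF assms(1) Vc]] by (auto simp: lam0)
  have "degree q \<le> k" using q(1) by (intro degree_le) auto
  moreover have "\<forall>\<^sub>F n in sequentially. 0 \<le> poly q (real n) \<and> lam (rsub M (Sn_span R k M X n V)) = ennreal (poly q (real n))"
    using q(2)
  proof eventually_elim
    case (elim n)
    then show ?case using fin[of n] by (simp flip: elim)
  qed
  moreover have "lam (rsub M V) < \<infinity>" by (rule length_fg_finite[OF lam md assms(2,3)])
  ultimately have "hilbert_pair R lam k M X V q" unfolding hilbert_pair_def using assms(3,4) by blast
  then show ?thesis by (rule that)
qed

text \<open>This uniform bound makes the maximum of degrees in \<open>msup\<close>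
  meaningful.\<close>

lemma mu_small_degree:
  assumes "smodule R k M X" "lam_small R lam k M X" "mu_small R lam k M X = Mon r d"
  shows "d \<le> k"
proof -
  obtain V where "fg_rsub R M V" "sspan R k M X V = carrier M"
    using fg_smodE[OF assms(1)] assms(2) unfolding lam_small_def by blast
  then obtain q where q: "hilbert_pair R lam k M X V q"
    using exists_hilbert_pair[OF assms(1)] assms(2) unfolding lam_small_def by blast
  then show ?thesis using mu_small_eq[OF lam assms(1) q] assms(3) hilbert_pairD(3)[OF q]
    by (auto simp: lead_mono_def split: if_splits)
qed

lemma mu_small_exact:
  assumes A: "smodule R k A XA" and B: "smodule R k B XB" and C: "smodule R k C XC"
    and f: "f \<in> shom R k A XA B XB" and g: "g \<in> shom R k B XB C XC"
    and ex: "short_exact R A B C f g" and small: "lam_small R lam k B XB"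
  shows "lam_small R lam k A XA" "lam_small R lam k C XC"
    "mu_small R lam k B XB = mplus (mu_small R lam k A XA) (mu_small R lam k C XC)"
proof -
  note mA = smoduleD(1)[OF A] and mB = smoduleD(1)[OF B] and mC = smoduleD(1)[OF C]
  note fh = shomD(1)[OF f] and gh = shomD(1)[OF g]
  have inj: "inj_on f (carrier A)" and surj: "g ` carrier B = carrier C"
    and ker: "f ` carrier A = {b \<in> carrier B. g b = \<zero>\<^bsub>C\<^esub>}"
    using ex unfolding short_exact_def by auto
  have finB: "loc_finite R lam B" and fgB: "fg_smod R k B XB" using small unfolding lam_small_def by auto
  have finA: "loc_finite R lam A" by (rule loc_finite_inj[OF lam mA mB fh inj finB])
  have finC: "loc_finite R lam C" by (rule loc_finite_surj[OF lam mB mC gh surj finB])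
  obtain V where V: "fg_rsub R B V" "sspan R k B XB V = carrier B" using fg_smodE[OF B fgB] .
  have Vc: "V \<subseteq> carrier B" by (rule submoduleD(1)[OF mB submodule_of_fg[OF mB V(1)]])
  note Ssub = submodule_Sn_span[OF B Vc]
  obtain q where q: "hilbert_pair R lam k B XB V q" using exists_hilbert_pair[OF B finB V] .
  have gV: "fg_rsub R C (g ` V)" by (rule fg_rsub_image[OF mB mC gh V(1)])
  have gV': "sspan R k C XC (g ` V) = carrier C" using image_sspan[OF B C g Vc] V(2) surj by simp
  show smallC: "lam_small R lam k C XC" unfolding lam_small_def using fg_smodI[OF C gV gV'] finC by blast
  obtain r where r: "hilbert_pair R lam k C XC (g ` V) r" using exists_hilbert_pair[OF C finC gV gV'] .
  \<comment> \<open>\<open>N n\<close> is the part of \<open>S_n V\<close> in the image of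
    \<open>A\<close>. It is studied inside \<open>B\<close>, where the filtration lives, and pulled
    back along \<open>f\<close> only afterwards.\<close>
  define N where "N n = {b \<in> Sn_span R k B XB n V. g b = \<zero>\<^bsub>C\<^esub>}" for n
  have Nsub: "submodule (N n) R B" for n
    unfolding N_def using submodule_vimage[OF mB mC gh Ssub submodule_zero[OF mC]] by simp
  have sm: "smodule R (Suc k) B (XB(k := id))" by (rule smodule_add_identity[OF B])
  have Ngr: "graded_sub R (Suc k) B (XB(k := id)) N"
  proof (rule graded_subI[OF Nsub])
    fix n i v assume i: "i < Suc k" and v: "v \<in> N n"
    have vc: "v \<in> carrier B" by (rule submoduleD(3)[OF mB Nsub v])
    have "g ((XB(k := id)) i v) = \<zero>\<^bsub>C\<^esub>"
      using v i vc shomD(2)[OF g, of i v] rhom_zero[OF mC mC smoduleD(2)[OF C]] by (cases "i = k") (auto simp: N_def)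
    then show "(XB(k := id)) i v \<in> N (Suc n)"
      using graded_subD(2)[OF rees_graded(1)[OF B Vc] i] v by (simp add: N_def)
  qed
  have NS: "N n \<subseteq> Sn_span R k B XB n V" for n unfolding N_def by blast
  have zN: "{\<zero>\<^bsub>B\<^esub>} \<subseteq> N n" for n using submoduleD(2)[OF mB Nsub] by blast
  have "graded_fg R (Suc k) B (XB(k := id)) N (\<lambda>n. {\<zero>\<^bsub>B\<^esub>})"
    by (rule graded_hilbert_basis[OF noeth sm rees_graded(1)[OF B Vc] graded_sub_zero[OF sm] Ngr
        fg_Sn_span[OF B V(1)] zN NS rees_graded(2)[OF B Vc]])
  \<comment> \<open>\<open>c\<close> is a degree from which on \<open>N\<close> grows only by
    applying variables; it plays the role of the Artin-Rees constant.\<close>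
  then obtain c where c: "\<And>n. n \<ge> c \<Longrightarrow> N (Suc n) \<subseteq> rspan R B ({\<zero>\<^bsub>B\<^esub>} \<union> (N n \<union> (\<Union>i<k. XB i ` N n)))"
    unfolding graded_fg_def UN_add_identity eventually_sequentially by blast
  have Nc: "N n \<subseteq> carrier B" for n by (rule submoduleD(1)[OF mB Nsub])
  have SN: "Sn_span R k B XB n (N c) = N (n + c)" for n
  proof
    show "Sn_span R k B XB n (N c) \<subseteq> N (n + c)"
    proof (rule Sn_span_least[of "\<lambda>n. N (n + c)"])
      fix n i v
      show "N (n + c) \<subseteq> N (Suc n + c)" using graded_subD(2)[OF Ngr, of k _ "n + c"] by auto
      assume "i < k" "v \<in> N (n + c)"
      then show "XB i v \<in> N (Suc n + c)" using graded_subD(2)[OF Ngr, of i v "n + c"] by auto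
    qed (use Nsub in auto)
    show "N (n + c) \<subseteq> Sn_span R k B XB n (N c)"
    proof (induction n)
      case 0
      then show ?case using subset_Sn_span by simp
    next
      case (Suc n)
      have "{\<zero>\<^bsub>B\<^esub>} \<union> (N (n + c) \<union> (\<Union>i<k. XB i ` N (n + c))) \<subseteq> Sn_span R k B XB (Suc n) (N c)"
      proof (intro Un_least UN_least)
        show "{\<zero>\<^bsub>B\<^esub>} \<subseteq> Sn_span R k B XB (Suc n) (N c)" using submoduleD(2)[OF mB submodule_Sn_span[OF B Nc]] by blast
        show "N (n + c) \<subseteq> Sn_span R k B XB (Suc n) (N c)"
          by (rule order_trans[OF Suc.IH Sn_span_mono]) auto
        fix i assume "i \<in> {..<k}"
        then show "XB i ` N (n + c) \<subseteq> Sn_span R k B XB (Suc n) (N c)" using Suc.IH Sn_span_step[OF B Nc] by blast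
      qed
      then have "rspan R B ({\<zero>\<^bsub>B\<^esub>} \<union> (N (n + c) \<union> (\<Union>i<k. XB i ` N (n + c)))) \<subseteq> Sn_span R k B XB (Suc n) (N c)"
        by (rule rspan_least[OF submodule_Sn_span[OF B Nc]])
      then show ?case using c[of "n + c"] by auto
    qed
  qed
  define W where "W = {a \<in> carrier A. f a \<in> N c}"
  have Wsub: "submodule W R A" unfolding W_def by (rule submodule_vimage[OF mA mB fh submodule_carrier[OF mA] Nsub])
  have Wc: "W \<subseteq> carrier A" unfolding W_def by blast
  have fW: "f ` W = N c"
  proof
    show "f ` W \<subseteq> N c" unfolding W_def by blast
    show "N c \<subseteq> f ` W"
    proof
      fix b assume b: "b \<in> N c"
      then have "b \<in> f ` carrier A" unfolding ker using Nc by (auto simp: N_def)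
      then show "b \<in> f ` W" unfolding W_def using b by blast
    qed
  qed
  have fSn: "f ` Sn_span R k A XA n W = N (n + c)" for n using image_Sn_span[OF A B f Wc] fW SN by simp
  have Wfg: "fg_rsub R A W"
  proof -
    have "fg_rsub R B (N c)"
      by (rule fg_rsub_of_noetherian[OF mB noeth fg_Sn_span[OF B V(1)] Nsub NS])
    then obtain G where G: "finite G" "G \<subseteq> carrier B" "N c = rspan R B G" unfolding fg_rsub_def by blast
    then have "G \<subseteq> f ` W" using fW rspan_superset[of G R B] by simp
    \<comment> \<open>Finitely many generators of \<open>N c\<close> are lifted to \<open>W\<close>;
      injectivity of \<open>f\<close> then turns equality of images into equality of
      submodules.\<close>
    then obtain H where H: "H \<subseteq> W" "finite H" "G = f ` H" using finite_subset_image[OF G(1)] by metis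
    have Hc: "H \<subseteq> carrier A" using H(1) Wc by blast
    have "f ` rspan R A H = f ` W" using image_rspan[OF mA mB fh Hc] H(3) G(3) fW by simp
    then have "rspan R A H = W"
      using inj_on_image_eq_iff[OF inj] rspan_subset_carrier[OF mA Hc] Wc by blast
    then show ?thesis unfolding fg_rsub_def using H(2) Hc by blast
  qed
  \<comment> \<open>The image of an element of \<open>A\<close> lies in some \<open>S_n V\<close>,
    hence in \<open>N (n + c)\<close>, which is the image of \<open>S_n W\<close>.\<close>
  have Wspan: "sspan R k A XA W = carrier A"
  proof
    show "sspan R k A XA W \<subseteq> carrier A" by (rule sspan_least[OF ssub_carrier[OF A] Wc])
    show "carrier A \<subseteq> sspan R k A XA W"
    proof
      fix a assume a: "a \<in> carrier A"
      then have fa: "f a \<in> carrier B" "g (f a) = \<zero>\<^bsub>C\<^esub>" using ker by blast+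
      then obtain n where "f a \<in> Sn_span R k B XB n V" using V(2) unfolding sspan_eq_UN[OF B Vc] by blast
      then have "f a \<in> Sn_span R k B XB (n + c) V" using Sn_span_mono[of n "n + c" V V R k B XB] by auto
      then have "f a \<in> f ` Sn_span R k A XA n W" unfolding fSn N_def using fa by blast
      then have "a \<in> Sn_span R k A XA n W"
        using inj_on_image_mem_iff[OF inj a submoduleD(1)[OF mA submodule_Sn_span[OF A Wc]]] by blast
      then show "a \<in> sspan R k A XA W" unfolding sspan_eq_UN[OF A Wc] by blast
    qed
  qed
  show smallA: "lam_small R lam k A XA" unfolding lam_small_def using fg_smodI[OF A Wfg Wspan] finA by blast
  obtain p where p: "hilbert_pair R lam k A XA W p" using exists_hilbert_pair[OF A finA Wfg Wspan] .
  have split: "lam (rsub B (Sn_span R k B XB (n + c) V))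
      = lam (rsub A (Sn_span R k A XA n W)) + lam (rsub C (Sn_span R k C XC (n + c) (g ` V)))" for n
  proof -
    have "lam (rsub B (Sn_span R k B XB (n + c) V)) = lam (rsub B (N (n + c))) + lam (rsub C (g ` Sn_span R k B XB (n + c) V))"
      unfolding N_def by (rule length_hom[OF lam mB mC gh Ssub])
    also have "lam (rsub B (N (n + c))) = lam (rsub A (Sn_span R k A XA n W))"
      unfolding fSn[symmetric] by (rule length_inj[OF lam mA mB fh inj submodule_Sn_span[OF A Wc]])
    also have "g ` Sn_span R k B XB (n + c) V = Sn_span R k C XC (n + c) (g ` V)" by (rule image_Sn_span[OF B C g Vc])
    finally show ?thesis .
  qed
  \<comment> \<open>The degree \<open>n\<close> for \<open>A\<close> corresponds to
    \<open>n + c\<close> for \<open>B\<close> and \<open>C\<close>, so the latter polynomials are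
    shifted to a common argument.\<close>
  define q' r' where "q' = q \<circ>\<^sub>p [:real c, 1:]" and "r' = r \<circ>\<^sub>p [:real c, 1:]"
  have q': "poly q' (real n) = poly q (real (n + c))" and r': "poly r' (real n) = poly r (real (n + c))" for n
    by (simp_all add: q'_def r'_def poly_pcompose add.commute)
  note P = hilbert_pairD(4,5)[OF p]
  note Q = hilbert_pairD(4,5)[OF q, THEN sequentially_offset[where k = c]]
  note Rr = hilbert_pairD(4,5)[OF r, THEN sequentially_offset[where k = c]]
  have eq: "\<forall>\<^sub>F n in sequentially. poly q' (real n) = poly (p + r') (real n)"
    using P Q Rr
  proof eventually_elim
    case (elim n)
    have "ennreal (poly q (real (n + c))) = ennreal (poly p (real n)) + ennreal (poly r (real (n + c)))"
      using split[of n] elim by simp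
    also have "\<dots> = ennreal (poly p (real n) + poly r (real (n + c)))" using elim by (intro ennreal_plus[symmetric])
    finally show ?case using elim unfolding q' poly_add r' by (subst (asm) ennreal_inj) auto
  qed
  have Q': "\<forall>\<^sub>F n in sequentially. 0 \<le> poly q' (real n)" using Q(1) unfolding q' .
  have R': "\<forall>\<^sub>F n in sequentially. 0 \<le> poly r' (real n)" using Rr(1) unfolding r' .
  \<comment> \<open>The polynomials are known to agree at large integers, and comparing growth in
    both directions identifies their leading monomials.\<close>
  have "lead_mono q' = lead_mono (p + r')"
  proof (rule mono_le_antisym)
    show "mono_le (lead_mono q') (lead_mono (p + r'))"
      by (rule lead_mono_mono[OF Q']) (use eq in \<open>eventually_elim, simp\<close>)
    have "\<forall>\<^sub>F n in sequentially. 0 \<le> poly (p + r') (real n)" using P(1) R' by eventually_elim simp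
    then show "mono_le (lead_mono (p + r')) (lead_mono q')"
      by (rule lead_mono_mono) (use eq in \<open>eventually_elim, simp\<close>)
  qed
  also have "\<dots> = mplus (lead_mono p) (lead_mono r')" by (rule lead_mono_add[OF P(1) R'])
  finally have "lead_mono q' = mplus (lead_mono p) (lead_mono r')" .
  then show "mu_small R lam k B XB = mplus (mu_small R lam k A XA) (mu_small R lam k C XC)"
    unfolding mu_small_eq[OF lam A p] mu_small_eq[OF lam B q] mu_small_eq[OF lam C r] q'_def r'_def lead_mono_shift .
qed

text \<open>Generators of the smaller submodule lie in some \<open>S_c V2\<close> for generators
  \<open>V2\<close> of the larger one. Both filtrations are computed in \<open>M\<close>, where they
  can be compared.\<close>

lemma mu_small_mono:
  assumes M: "smodule R k M X" and N: "ssub R k M X N1" "ssub R k M X N2" "N1 \<subseteq> N2"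
    and small: "lam_small R lam k (rsub M N1) X" "lam_small R lam k (rsub M N2) X"
  shows "mono_le (mu_small R lam k (rsub M N1) X) (mu_small R lam k (rsub M N2) X)"
proof -
  note md = smoduleD(1)[OF M]
  note s1 = smodule_rsub[OF M N(1)] and s2 = smodule_rsub[OF M N(2)]
  have *: "\<exists>V q. hilbert_pair R lam k (rsub M N) X V q \<and> V \<subseteq> N \<and> fg_rsub R M V \<and> sspan R k M X V = N"
    if N: "ssub R k M X N" and small: "lam_small R lam k (rsub M N) X" for N
  proof -
    note sN = smodule_rsub[OF M N]
    have fin: "loc_finite R lam (rsub M N)" and fg: "fg_smod R k (rsub M N) X" using small unfolding lam_small_def by auto
    obtain V where V: "fg_rsub R (rsub M N) V" "sspan R k (rsub M N) X V = carrier (rsub M N)" using fg_smodE[OF sN fg] .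
    obtain q where q: "hilbert_pair R lam k (rsub M N) X V q" using exists_hilbert_pair[OF sN fin V] .
    have VN: "V \<subseteq> N" using sspan_superset[of V R k "rsub M N" X] V(2) by simp
    have "fg_rsub R M V" by (rule fg_rsub_of_rsub[OF md ssubD(1)[OF N] V(1)])
    moreover have "sspan R k M X V = N" using sspan_rsub[OF M N VN] V(2) by simp
    ultimately show ?thesis using q VN by blast
  qed
  obtain V1 p where 1: "hilbert_pair R lam k (rsub M N1) X V1 p" "V1 \<subseteq> N1" "fg_rsub R M V1" using *[OF N(1) small(1)] by blast
  obtain V2 q where 2: "hilbert_pair R lam k (rsub M N2) X V2 q" "V2 \<subseteq> N2" "sspan R k M X V2 = N2" using *[OF N(2) small(2)] by blast
  have c: "V1 \<subseteq> carrier M" "V2 \<subseteq> carrier M"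
    using 1(2) 2(2) submoduleD(1)[OF md ssubD(1)[OF N(1)]] submoduleD(1)[OF md ssubD(1)[OF N(2)]] by auto
  have "V1 \<subseteq> sspan R k M X V2" using 1(2) 2(3) N(3) by simp
  then obtain c where "V1 \<subseteq> Sn_span R k M X c V2" by (rule fg_subset_Sn_span[OF M c(2) 1(3)])
  then have "mono_le (lead_mono p) (lead_mono q)"
    by (intro lead_mono_le_of_Sn_span[OF lam M 1(1) 2(1) _ _ c])
      (simp_all add: Sn_span_rsub[OF M N(1) 1(2)] Sn_span_rsub[OF M N(2) 2(2)])
  then show ?thesis unfolding mu_small_eq[OF lam s1 1(1)] mu_small_eq[OF lam s2 2(1)] .
qed

end

section \<open>Passage from small modules to locally finite modules\<close>

theorem theorem6p1:
  fixes R :: "'r ring" and lam :: "('r,'u) module \<Rightarrow> ennreal" and k :: nat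
    and A B C :: "('r,'u) module" and XA XB XC :: "nat \<Rightarrow> 'u \<Rightarrow> 'u"
    and \<iota> \<pi> :: "'u \<Rightarrow> 'u"
  assumes "cring R" and "noetherian_ring R" and "length_function R lam"
    and "smodule R k A XA" and "smodule R k B XB" and "smodule R k C XC"
    and "\<iota> \<in> shom R k A XA B XB" and "\<pi> \<in> shom R k B XB C XC"
    and "short_exact R A B C \<iota> \<pi>"
    and "loc_finite R lam B"
  shows "mu R lam k B XB = mplus (mu R lam k A XA) (mu R lam k C XC)"
proof -
  note lam = assms(3) and noeth = assms(2) and A = assms(4) and B = assms(5) and C = assms(6)
    and f = assms(7) and g = assms(8) and ex = assms(9) and finB = assms(10)
  note mA = smoduleD(1)[OF A] and mB = smoduleD(1)[OF B] and mC = smoduleD(1)[OF C]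
  note fh = shomD(1)[OF f] and gh = shomD(1)[OF g]
  have inj: "inj_on \<iota> (carrier A)" and surj: "\<pi> ` carrier B = carrier C"
    and ker: "\<iota> ` carrier A = {b \<in> carrier B. \<pi> b = \<zero>\<^bsub>C\<^esub>}"
    using ex unfolding short_exact_def by auto
  have finA: "loc_finite R lam A" by (rule loc_finite_inj[OF lam mA mB fh inj finB])
  have finC: "loc_finite R lam C" by (rule loc_finite_surj[OF lam mB mC gh surj finB])
  define I where "I M X = {mu_small R lam k (rsub M N) X | N. ssub R k M X N \<and> lam_small R lam k (rsub M N) X}"
    for M and X :: "nat \<Rightarrow> 'u \<Rightarrow> 'u"
  have mu: "mu R lam k M X = msup (I M X)" for M X unfolding mu_def I_def ..
  have deg: "d \<le> k" if M: "smodule R k M X" and m: "Mon r d \<in> I M X" for M X r d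
  proof -
    obtain N where "ssub R k M X N" "lam_small R lam k (rsub M N) X" "mu_small R lam k (rsub M N) X = Mon r d"
      using m unfolding I_def by auto
    then show ?thesis using mu_small_degree[OF lam noeth smodule_rsub[OF M]] by blast
  qed
  have smallI: "lam_small R lam k (rsub M (sspan R k M X G)) X"
    if M: "smodule R k M X" and fin: "loc_finite R lam M" and G: "finite G" "G \<subseteq> carrier M" for M X G
  proof -
    note s = ssub_sspan[OF M G(2)]
    have "sspan R k (rsub M (sspan R k M X G)) X G = sspan R k M X G" by (rule sspan_rsub[OF M s sspan_superset])
    then have "fg_smod R k (rsub M (sspan R k M X G)) X"
      unfolding fg_smod_def using G(1) sspan_superset by (intro exI[of _ G]) simp
    then show ?thesis unfolding lam_small_def
      using loc_finite_rsub[OF smoduleD(1)[OF M] ssubD(1)[OF s] fin] by blast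
  qed
  \<comment> \<open>The submodule spanned by the empty set is small. Nonemptiness is what allows a
    supremum to be taken inside a sum.\<close>
  have ne: "I M X \<noteq> {}" if M: "smodule R k M X" and fin: "loc_finite R lam M" for M X
    using smallI[OF M fin, of "{}"] ssub_sspan[OF M, of "{}"] unfolding I_def by blast
  \<comment> \<open>A small submodule \<open>N\<close> of \<open>B\<close> cuts out an exact
    sequence with small middle term, to which additivity for small modules applies.\<close>
  have restrict: "lam_small R lam k (rsub A {a \<in> carrier A. \<iota> a \<in> N}) XA \<and> lam_small R lam k (rsub C (\<pi> ` N)) XC
      \<and> ssub R k A XA {a \<in> carrier A. \<iota> a \<in> N} \<and> ssub R k C XC (\<pi> ` N)
      \<and> mu_small R lam k (rsub B N) XB
        = mplus (mu_small R lam k (rsub A {a \<in> carrier A. \<iota> a \<in> N}) XA) (mu_small R lam k (rsub C (\<pi> ` N)) XC)"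
    if N: "ssub R k B XB N" and small: "lam_small R lam k (rsub B N) XB" for N
  proof -
    let ?A = "{a \<in> carrier A. \<iota> a \<in> N}"
    note ND = submoduleD[OF mB ssubD(1)[OF N]]
    have sA: "ssub R k A XA ?A" unfolding ssub_def
      using submodule_vimage[OF mA mB fh submodule_carrier[OF mA] ssubD(1)[OF N]]
        rhomD(1)[OF smoduleD(2)[OF A]] shomD(2)[OF f] ssubD(2)[OF N] by auto
    have sC: "ssub R k C XC (\<pi> ` N)" unfolding ssub_def
    proof (intro conjI allI impI ballI)
      show "submodule (\<pi> ` N) R C" by (rule submodule_image[OF mB mC gh ssubD(1)[OF N]])
      fix i v assume i: "i < k" and "v \<in> \<pi> ` N"
      then obtain b where b: "b \<in> N" "v = \<pi> b" by blast
      then have "XC i v = \<pi> (XB i b)" using shomD(2)[OF g i] ND(3) by simp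
      then show "XC i v \<in> \<pi> ` N" using ssubD(2)[OF N i b(1)] by blast
    qed
    have f': "\<iota> \<in> shom R k (rsub A ?A) XA (rsub B N) XB"
      using f rhomD[OF fh] unfolding shom_def rhom_def by auto
    have g': "\<pi> \<in> shom R k (rsub B N) XB (rsub C (\<pi> ` N)) XC"
      using g rhomD[OF gh] ND(3) unfolding shom_def rhom_def by auto
    have "\<iota> ` ?A = {b \<in> N. \<pi> b = \<zero>\<^bsub>C\<^esub>}"
    proof
      show "\<iota> ` ?A \<subseteq> {b \<in> N. \<pi> b = \<zero>\<^bsub>C\<^esub>}" using ker by blast
      show "{b \<in> N. \<pi> b = \<zero>\<^bsub>C\<^esub>} \<subseteq> \<iota> ` ?A"
      proof
        fix b assume b: "b \<in> {b \<in> N. \<pi> b = \<zero>\<^bsub>C\<^esub>}"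
        then have "b \<in> \<iota> ` carrier A" unfolding ker using ND(3) by blast
        then show "b \<in> \<iota> ` ?A" using b by blast
      qed
    qed
    then have ex': "short_exact R (rsub A ?A) (rsub B N) (rsub C (\<pi> ` N)) \<iota> \<pi>"
      unfolding short_exact_def using shomD(1)[OF f'] shomD(1)[OF g'] inj_on_subset[OF inj, of ?A] by auto
    show ?thesis
      using mu_small_exact[OF lam noeth smodule_rsub[OF A sA] smodule_rsub[OF B N] smodule_rsub[OF C sC] f' g' ex' small]
        sA sC by blast
  qed
  have "mono_le (msup (I B XB)) (mplus (msup (I A XA)) (msup (I C XC)))"
  proof (rule msup_least[of _ k])
    fix m assume "m \<in> I B XB"
    then obtain N where N: "ssub R k B XB N" "lam_small R lam k (rsub B N) XB" "m = mu_small R lam k (rsub B N) XB"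
      unfolding I_def by blast
    note r = restrict[OF N(1,2)]
    have a: "mu_small R lam k (rsub A {a \<in> carrier A. \<iota> a \<in> N}) XA \<in> I A XA" using r unfolding I_def by blast
    have c: "mu_small R lam k (rsub C (\<pi> ` N)) XC \<in> I C XC" using r unfolding I_def by blast
    have "mono_le (mplus (mu_small R lam k (rsub A {a \<in> carrier A. \<iota> a \<in> N}) XA) (mu_small R lam k (rsub C (\<pi> ` N)) XC))
      (mplus (msup (I A XA)) (msup (I C XC)))"
      by (rule mplus_mono[OF msup_upper[OF deg[OF A] a] msup_upper[OF deg[OF C] c]])
    then show "mono_le m (mplus (msup (I A XA)) (msup (I C XC)))" using r N(3) by simp
  qed (rule deg[OF B])
  \<comment> \<open>The two suprema are resolved one at a time. Continuity is available in the left
    argument, hence the swaps by commutativity.\<close>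
  moreover have "mono_le (mplus (msup (I A XA)) (msup (I C XC))) (msup (I B XB))"
  proof (rule mplus_msup_least[of _ k])
    fix a assume a: "a \<in> I A XA"
    have "mono_le (mplus (msup (I C XC)) a) (msup (I B XB))"
    proof (rule mplus_msup_least[of _ k])
      fix c assume c: "c \<in> I C XC"
      obtain N1 where N1: "ssub R k A XA N1" "lam_small R lam k (rsub A N1) XA" "a = mu_small R lam k (rsub A N1) XA"
        using a unfolding I_def by blast
      obtain N2 where N2: "ssub R k C XC N2" "lam_small R lam k (rsub C N2) XC" "c = mu_small R lam k (rsub C N2) XC"
        using c unfolding I_def by blast
      obtain G1 where G1: "finite G1" "G1 \<subseteq> N1" "sspan R k (rsub A N1) XA G1 = N1"
        using N1(2) unfolding lam_small_def fg_smod_def by auto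
      have G1s: "sspan R k A XA G1 = N1" using sspan_rsub[OF A N1(1) G1(2)] G1(3) by simp
      have G1c: "G1 \<subseteq> carrier A" using G1(2) submoduleD(1)[OF mA ssubD(1)[OF N1(1)]] by blast
      obtain G2 where G2: "finite G2" "G2 \<subseteq> N2" "sspan R k (rsub C N2) XC G2 = N2"
        using N2(2) unfolding lam_small_def fg_smod_def by auto
      have G2s: "sspan R k C XC G2 = N2" using sspan_rsub[OF C N2(1) G2(2)] G2(3) by simp
      have "G2 \<subseteq> \<pi> ` carrier B" unfolding surj using G2(2) submoduleD(1)[OF mC ssubD(1)[OF N2(1)]] by blast
      then obtain H where H: "H \<subseteq> carrier B" "finite H" "G2 = \<pi> ` H" using finite_subset_image[OF G2(1)] by metis
      \<comment> \<open>Images of the generators of \<open>N1\<close> together with lifts of the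
        generators of \<open>N2\<close>: the span of \<open>G\<close> dominates both given
        submodules.\<close>
      define G where "G = \<iota> ` G1 \<union> H"
      have G: "finite G" "G \<subseteq> carrier B" unfolding G_def using G1(1) H G1c rhomD(1)[OF fh] by auto
      define N where "N = sspan R k B XB G"
      have N: "ssub R k B XB N" "lam_small R lam k (rsub B N) XB"
        unfolding N_def using ssub_sspan[OF B G(2)] smallI[OF B finB G] by auto
      note r = restrict[OF N]
      have GN: "G \<subseteq> N" unfolding N_def by (rule sspan_superset)
      \<comment> \<open>The images of \<open>G1\<close> vanish in \<open>C\<close>, so the image of
        \<open>N\<close> is exactly \<open>N2\<close>.\<close>
      have "\<pi> ` G \<subseteq> insert \<zero>\<^bsub>C\<^esub> G2" unfolding G_def using ker G1c H(3) by blast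
      then have "sspan R k C XC (\<pi> ` G) \<subseteq> N2"
        using G2(2) submoduleD(2)[OF mC ssubD(1)[OF N2(1)]] by (intro sspan_least[OF N2(1)]) auto
      moreover have "N2 \<subseteq> sspan R k C XC (\<pi> ` G)"
        unfolding G2s[symmetric] by (rule sspan_mono) (auto simp: G_def H(3))
      ultimately have piN: "\<pi> ` N = N2" unfolding N_def image_sspan[OF B C g G(2)] by blast
      \<comment> \<open>\<open>N\<close> may meet \<open>A\<close> in more than \<open>N1\<close>,
        so on this side an inclusion is used, and monotonicity for small modules closes the
        gap.\<close>
      have "N1 \<subseteq> {a \<in> carrier A. \<iota> a \<in> N}"
        unfolding G1s[symmetric] by (rule sspan_least) (use r G1c GN in \<open>auto simp: G_def\<close>)
      then have "mono_le a (mu_small R lam k (rsub A {a \<in> carrier A. \<iota> a \<in> N}) XA)"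
        unfolding N1(3) using r N1(2) by (intro mu_small_mono[OF lam noeth A N1(1)]) auto
      from mplus_mono[OF this mono_le_refl[of c]]
      have le: "mono_le (mplus a c) (mu_small R lam k (rsub B N) XB)"
        using r unfolding piN N2(3) by simp
      have "mu_small R lam k (rsub B N) XB \<in> I B XB" unfolding I_def using N by blast
      from mono_le_trans[OF le msup_upper[OF deg[OF B] this]]
      show "mono_le (mplus c a) (msup (I B XB))" by (simp add: mplus_commute)
    qed (use deg[OF C] ne[OF C finC] in auto)
    then show "mono_le (mplus a (msup (I C XC))) (msup (I B XB))" by (simp add: mplus_commute)
  qed (use deg[OF A] ne[OF A finA] in auto)
  ultimately show ?thesis unfolding mu by (rule mono_le_antisym)
qed

end
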